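(* Let $\mathbb{K}$ be an algebraically closed field, $n\ge 1$, and $\mathbb{K}[[X]]=\mathbb{K}[[x_1,\ldots,x_n]]$. Let $f\in\mathbb{K}[[X]][y]$ be a Puiseux polynomial with $\operatorname{char}(\mathbb{K})\nmid\deg(f)$, let $\xi\in\mathbb{K}[[X^*]]$ be a root of $f$, and let $\lambda^{(1)},\ldots,\lambda^{(g)}\in\big(\frac{1}{k}\mathbb{Z}_{\ge 0}\big)^n$ (with $k$ a positive integer) be a set of distinguished exponents of $\xi$. Then there exists a $\mathbb{K}$-algebra isomorphism between the normalization of $\mathbb{K}[[X]][\xi]$ and $\mathbb{K}[[\bar{S}]]$, where $\bar{S}$ is the saturation of the affine semigroup $S$ generated by $(\mathbb{Z}_{\ge 0})^n$ and $\lambda^{(1)},\ldots,\lambda^{(g)}$.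
   Context: The ring of Puiseux series is $\mathbb{K}[[X^*]]:=\bigcup_{m\in\mathbb{Z}_{>0}}\mathbb{K}[[x_1^{1/m},\ldots,x_n^{1/m}]]$. A monic polynomial $f\in\mathbb{K}[[X]][y]$ is a Puiseux polynomial if there exist $\xi_1,\ldots,\xi_d\in\mathbb{K}[[X^*]]$ with $f=\prod_{i=1}^d(y-\xi_i)$. $\operatorname{Supp}(\xi)\subset(\mathbb{Q}_{\ge 0})^n$ is the set of exponents appearing in $\xi$ with non-zero coefficient, and $\mathbb{K}((X))$ is the field of fractions of $\mathbb{K}[[X]]$. A set $\{\lambda^{(1)},\ldots,\lambda^{(g)}\}\subset\operatorname{Supp}(\xi)$ is a set of distinguished exponents of $\xi$ if $\mathbb{K}((X))(\xi)=\mathbb{K}((X))(X^{\lambda^{(1)}},\ldots,X^{\lambda^{(g)}})$. The normalization of a domain is its integral closure in its field of fractions. "Semigroup generated by" means the commutative monoid of finite non-negative integer combinations. A monoid $S\subset\mathbb{Q}^n$ is saturated if for all positive integers $k$ and all $m\in\mathbb{Z}S$ (the group generated by $S$), $km\in S$ implies $m\in S$; the saturation $\bar{S}$ of $S$ is the smallest saturated monoid containing $S$. For a monoid $S\subset(\mathbb{Q}_{\ge 0})^n$ as here, $\mathbb{K}[[S]]$ is the ring of all formal series $\sum_{\alpha\in\Lambda}a_\alpha X^\alpha$ with $a_\alpha\in\mathbb{K}$ and $\Lambda\subseteq S$. *)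

theory Defs
  imports
    "HOL-Analysis.Finite_Cartesian_Product"
    "HOL-Computational_Algebra.Polynomial_Factorial"
begin

section \<open>Exponents\<close>

text \<open>
  Exponents are vectors in \<open>\<rat>\<^sup>n\<close>, with \<open>n = CARD('n) \<ge> 1\<close>.
\<close>

definition nat_exps :: "(rat ^ 'n) set" where
  "nat_exps = {\<alpha>. \<forall>i. \<alpha> $ i \<in> \<nat>}"

text \<open>\<open>frac_exps m\<close> is \<open>((1/m) \<int>\<^sub>\<ge>\<^sub>0)\<^sup>n\<close>; it is only used for \<open>m > 0\<close>.\<close>

definition frac_exps :: "nat \<Rightarrow> (rat ^ 'n) set" where
  "frac_exps m = {\<alpha>. \<forall>i. \<exists>a::nat. \<alpha> $ i = of_nat a / of_nat m}"

lemma frac_exps_1: "frac_exps 1 = nat_exps"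
  by (auto simp: frac_exps_def nat_exps_def Nats_def image_def)

lemma frac_expsE:
  assumes "\<alpha> \<in> frac_exps m"
  obtains a :: nat where "\<alpha> $ i = of_nat a / of_nat m"
  using assms unfolding frac_exps_def by blast

lemma zero_in_frac_exps [simp]: "0 \<in> frac_exps m"
  by (auto simp: frac_exps_def intro: exI [of _ 0])

lemma frac_exps_nonneg: "\<alpha> \<in> frac_exps m \<Longrightarrow> 0 \<le> \<alpha> $ i"
  by (erule frac_expsE [of _ _ i]) simp

lemma frac_exps_add:
  assumes "\<alpha> \<in> frac_exps m" "\<beta> \<in> frac_exps m"
  shows "\<alpha> + \<beta> \<in> frac_exps m"
proof -
  have "\<exists>a::nat. \<alpha> $ i + \<beta> $ i = of_nat a / of_nat m" for i
  proof -
    obtain a b :: nat where "\<alpha> $ i = of_nat a / of_nat m" "\<beta> $ i = of_nat b / of_nat m"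
      using assms frac_expsE by metis
    hence "\<alpha> $ i + \<beta> $ i = of_nat (a + b) / of_nat m"
      by (simp add: add_divide_distrib)
    thus ?thesis by blast
  qed
  thus ?thesis by (simp add: frac_exps_def)
qed

lemma frac_exps_mult:
  assumes "k > 0"
  shows "frac_exps m \<subseteq> frac_exps (m * k)"
proof
  fix \<alpha> :: "rat ^ 'n" assume \<alpha>: "\<alpha> \<in> frac_exps m"
  have "\<exists>a::nat. \<alpha> $ i = of_nat a / of_nat (m * k)" for i
  proof -
    obtain a :: nat where "\<alpha> $ i = of_nat a / of_nat m"
      using \<alpha> by (rule frac_expsE)
    hence "\<alpha> $ i = of_nat (a * k) / of_nat (m * k)"
      using assms by simp
    thus ?thesis by blast
  qed
  thus "\<alpha> \<in> frac_exps (m * k)" by (simp add: frac_exps_def)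
qed

lemma nonneg_imp_frac_exps:
  fixes \<alpha> :: "rat ^ 'n"
  assumes "0 \<le> \<alpha>"
  shows "\<exists>m>0. \<alpha> \<in> frac_exps m"
proof -
  define d where "d i = nat (snd (quotient_of (\<alpha> $ i)))" for i
  have d: "d i > 0" for i
    using quotient_of_denom_pos' by (simp add: d_def)
  have "\<exists>a::nat. \<alpha> $ i = of_nat a / of_nat (\<Prod>j\<in>UNIV. d j)" for i
  proof -
    define p where "p = fst (quotient_of (\<alpha> $ i))"
    have eq: "\<alpha> $ i = of_int p / of_nat (d i)"
      using quotient_of_div [of "\<alpha> $ i"] quotient_of_denom_pos' [of "\<alpha> $ i"]
      by (simp add: p_def d_def prod_eq_iff)
    have "0 \<le> \<alpha> $ i" using assms by (simp add: less_eq_vec_def)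
    hence "p \<ge> 0" using d [of i] by (simp add: eq zero_le_divide_iff)
    then obtain q :: nat where q: "p = int q" using nonneg_int_cases by blast
    have "(\<Prod>j\<in>UNIV. d j) = d i * (\<Prod>j\<in>UNIV - {i}. d j)"
      by (simp add: prod.remove)
    moreover have "(\<Prod>j\<in>UNIV - {i}. d j) > 0" using d by (simp add: prod_pos)
    ultimately have "\<alpha> $ i = of_nat (q * (\<Prod>j\<in>UNIV - {i}. d j)) / of_nat (\<Prod>j\<in>UNIV. d j)"
      using d [of i] by (simp add: eq q)
    thus ?thesis by blast
  qed
  moreover have "(\<Prod>j\<in>UNIV. d j) > 0" using d by (simp add: prod_pos)
  ultimately show ?thesis unfolding frac_exps_def by blast
qed

definition splits :: "nat \<Rightarrow> rat ^ 'n \<Rightarrow> (rat ^ 'n) set" where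
  "splits m \<gamma> = {\<alpha> \<in> frac_exps m. \<gamma> - \<alpha> \<in> frac_exps m}"

lemma finite_splits:
  fixes \<gamma> :: "rat ^ 'n"
  assumes "m > 0"
  shows "finite (splits m \<gamma>)"
proof -
  define h :: "('n \<Rightarrow> nat) \<Rightarrow> rat ^ 'n" where "h a = (\<chi> i. of_nat (a i) / of_nat m)" for a
  define N where "N i = nat \<lceil>\<gamma> $ i * of_nat m\<rceil>" for i
  have "splits m \<gamma> \<subseteq> h ` PiE UNIV (\<lambda>i. {..N i})"
  proof
    fix \<alpha> assume \<alpha>: "\<alpha> \<in> splits m \<gamma>"
    hence "\<forall>i. \<exists>a::nat. \<alpha> $ i = of_nat a / of_nat m"
      by (simp add: splits_def frac_exps_def)
    then obtain a :: "'n \<Rightarrow> nat" where a: "\<And>i. \<alpha> $ i = of_nat (a i) / of_nat m"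
      by metis
    have "a i \<le> N i" for i
    proof -
      have "\<alpha> $ i \<le> \<gamma> $ i"
        using \<alpha> frac_exps_nonneg [of "\<gamma> - \<alpha>" m i] by (simp add: splits_def)
      hence "of_nat (a i) \<le> \<gamma> $ i * of_nat m"
        using assms by (simp add: a field_simps)
      thus ?thesis unfolding N_def by linarith
    qed
    moreover have "\<alpha> = h a" by (simp add: h_def a vec_eq_iff)
    ultimately show "\<alpha> \<in> h ` PiE UNIV (\<lambda>i. {..N i})" by auto
  qed
  thus ?thesis by (rule finite_subset) (intro finite_imageI finite_PiE, auto)
qed


section \<open>The ring of Puiseux series\<close>

typedef (overloaded) ('k, 'n) puiseux =
    "{f :: rat ^ 'n::finite \<Rightarrow> 'k::zero. \<exists>m>0. {\<alpha>. f \<alpha> \<noteq> 0} \<subseteq> frac_exps m}"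
  morphisms pcoeff Abs_puiseux
  by (rule exI [of _ "\<lambda>_. 0"]) (auto intro: exI [of _ 1])

setup_lifting type_definition_puiseux

definition Supp :: "('k::zero, 'n::finite) puiseux \<Rightarrow> (rat ^ 'n) set" where
  "Supp p = {\<alpha>. pcoeff p \<alpha> \<noteq> 0}"

text \<open>The monomial \<open>c X\<^sup>\<mu>\<close>; the side condition makes it zero for exponents outside \<open>(\<rat>\<^sub>\<ge>\<^sub>0)\<^sup>n\<close>.\<close>

lift_definition pmonom :: "'k::zero \<Rightarrow> rat ^ 'n::finite \<Rightarrow> ('k, 'n) puiseux"
  is "\<lambda>c \<mu> \<alpha>. if 0 \<le> \<mu> \<and> \<alpha> = \<mu> then c else 0"
proof -
  fix c :: 'k and \<mu> :: "rat ^ 'n"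
  show "\<exists>m>0. {\<alpha>. (if 0 \<le> \<mu> \<and> \<alpha> = \<mu> then c else 0) \<noteq> 0} \<subseteq> frac_exps m"
  proof (cases "0 \<le> \<mu>")
    case True
    then obtain m where "m > 0" "\<mu> \<in> frac_exps m" using nonneg_imp_frac_exps by blast
    thus ?thesis by auto
  qed auto
qed

abbreviation pconst :: "'k::zero \<Rightarrow> ('k, 'n::finite) puiseux" where
  "pconst c \<equiv> pmonom c 0"

abbreviation X_pow :: "rat ^ 'n \<Rightarrow> ('k::zero_neq_one, 'n::finite) puiseux" where
  "X_pow \<equiv> pmonom 1"

lemma common_frac_exps:
  assumes "\<exists>m>0. {\<alpha>. f \<alpha> \<noteq> 0} \<subseteq> frac_exps m" "\<exists>m>0. {\<alpha>. g \<alpha> \<noteq> 0} \<subseteq> frac_exps m"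
  obtains m where "m > 0" "{\<alpha>. f \<alpha> \<noteq> 0} \<subseteq> frac_exps m" "{\<alpha>. g \<alpha> \<noteq> 0} \<subseteq> frac_exps m"
proof -
  obtain m1 m2 where m: "m1 > 0" "m2 > 0"
    "{\<alpha>. f \<alpha> \<noteq> 0} \<subseteq> frac_exps m1" "{\<alpha>. g \<alpha> \<noteq> 0} \<subseteq> frac_exps m2"
    using assms by blast
  show ?thesis
    using that [of "m1 * m2"] m frac_exps_mult [of m2 m1] frac_exps_mult [of m1 m2]
    by (auto simp: mult.commute)
qed

text \<open>The sum is finite for factors with bounded denominators, see \<open>conv_splits\<close>.\<close>

definition conv :: "(rat ^ 'n \<Rightarrow> 'k::comm_ring) \<Rightarrow> (rat ^ 'n \<Rightarrow> 'k) \<Rightarrow> rat ^ 'n \<Rightarrow> 'k" where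
  "conv f g \<gamma> = (\<Sum>\<alpha> | f \<alpha> \<noteq> 0 \<and> g (\<gamma> - \<alpha>) \<noteq> 0. f \<alpha> * g (\<gamma> - \<alpha>))"

lemma conv_splits:
  assumes "m > 0" "{\<alpha>. f \<alpha> \<noteq> 0} \<subseteq> frac_exps m" "{\<alpha>. g \<alpha> \<noteq> 0} \<subseteq> frac_exps m"
  shows "conv f g \<gamma> = (\<Sum>\<alpha>\<in>splits m \<gamma>. f \<alpha> * g (\<gamma> - \<alpha>))"
  unfolding conv_def
  by (rule sum.mono_neutral_left) (use assms finite_splits in \<open>auto simp: splits_def\<close>)

lemma conv_frac_exps:
  assumes "{\<alpha>. f \<alpha> \<noteq> 0} \<subseteq> frac_exps m" "{\<alpha>. g \<alpha> \<noteq> 0} \<subseteq> frac_exps m"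
  shows "{\<gamma>. conv f g \<gamma> \<noteq> 0} \<subseteq> frac_exps m"
proof
  fix \<gamma> assume "\<gamma> \<in> {\<gamma>. conv f g \<gamma> \<noteq> 0}"
  hence "{\<alpha>. f \<alpha> \<noteq> 0 \<and> g (\<gamma> - \<alpha>) \<noteq> 0} \<noteq> {}"
    unfolding conv_def by (metis (mono_tags, lifting) mem_Collect_eq sum.empty)
  then obtain \<alpha> where "\<alpha> \<in> frac_exps m" "\<gamma> - \<alpha> \<in> frac_exps m"
    using assms by blast
  thus "\<gamma> \<in> frac_exps m" using frac_exps_add by fastforce
qed

lemma conv_commute: "conv f g = conv g f"
proof
  fix \<gamma> :: "rat ^ 'a"
  show "conv f g \<gamma> = conv g f \<gamma>"
    unfolding conv_def
    by (rule sum.reindex_bij_witness [of _ "\<lambda>\<alpha>. \<gamma> - \<alpha>" "\<lambda>\<alpha>. \<gamma> - \<alpha>"])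
       (auto simp: mult.commute)
qed

lemma conv_assoc:
  assumes m: "m > 0" and f: "{\<alpha>. f \<alpha> \<noteq> 0} \<subseteq> frac_exps m"
    and g: "{\<alpha>. g \<alpha> \<noteq> 0} \<subseteq> frac_exps m" and h: "{\<alpha>. h \<alpha> \<noteq> 0} \<subseteq> frac_exps m"
  shows "conv (conv f g) h = conv f (conv g h)"
proof
  fix \<gamma>
  have "conv (conv f g) h \<gamma> =
      (\<Sum>\<delta>\<in>splits m \<gamma>. \<Sum>\<alpha>\<in>splits m \<delta>. f \<alpha> * g (\<delta> - \<alpha>) * h (\<gamma> - \<delta>))"
    by (subst conv_splits [OF m conv_frac_exps [OF f g] h])
       (simp add: conv_splits [OF m f g] sum_distrib_right)
  also have "\<dots> = (\<Sum>(\<delta>, \<alpha>)\<in>Sigma (splits m \<gamma>) (splits m). f \<alpha> * g (\<delta> - \<alpha>) * h (\<gamma> - \<delta>))"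
    by (rule sum.Sigma) (use m finite_splits in auto)
  also have "\<dots> = (\<Sum>(\<alpha>, \<beta>)\<in>Sigma (splits m \<gamma>) (\<lambda>\<alpha>. splits m (\<gamma> - \<alpha>)).
      f \<alpha> * (g \<beta> * h (\<gamma> - \<alpha> - \<beta>)))"
  proof (rule sum.reindex_bij_witness
      [of _ "\<lambda>(\<alpha>, \<beta>). (\<alpha> + \<beta>, \<alpha>)" "\<lambda>(\<delta>, \<alpha>). (\<alpha>, \<delta> - \<alpha>)"], goal_cases)
    case (2 x)
    then obtain \<delta> \<alpha> where x: "x = (\<delta>, \<alpha>)"
      "\<gamma> - \<delta> \<in> frac_exps m" "\<alpha> \<in> frac_exps m" "\<delta> - \<alpha> \<in> frac_exps m"
      by (auto simp: splits_def)
    from frac_exps_add [OF x(2) x(4)] have "\<gamma> - \<alpha> \<in> frac_exps m" by simp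
    with x show ?case by (auto simp: splits_def)
  next
    case (4 x)
    then obtain \<alpha> \<beta> where x: "x = (\<alpha>, \<beta>)"
      "\<alpha> \<in> frac_exps m" "\<beta> \<in> frac_exps m" "\<gamma> - \<alpha> - \<beta> \<in> frac_exps m"
      by (auto simp: splits_def)
    with frac_exps_add [OF x(2) x(3)] show ?case by (auto simp: splits_def diff_diff_eq)
  qed (auto simp: mult.assoc)
  also have "\<dots> = (\<Sum>\<alpha>\<in>splits m \<gamma>. \<Sum>\<beta>\<in>splits m (\<gamma> - \<alpha>). f \<alpha> * (g \<beta> * h (\<gamma> - \<alpha> - \<beta>)))"
    by (rule sum.Sigma [symmetric]) (use m finite_splits in auto)
  also have "\<dots> = conv f (conv g h) \<gamma>"
    by (subst conv_splits [OF m f conv_frac_exps [OF g h]])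
       (simp add: conv_splits [OF m g h] sum_distrib_left)
  finally show "conv (conv f g) h \<gamma> = conv f (conv g h) \<gamma>" .
qed

lemma conv_add_left:
  assumes m: "m > 0" and f: "{\<alpha>. f \<alpha> \<noteq> 0} \<subseteq> frac_exps m"
    and g: "{\<alpha>. g \<alpha> \<noteq> 0} \<subseteq> frac_exps m" and h: "{\<alpha>. h \<alpha> \<noteq> 0} \<subseteq> frac_exps m"
  shows "conv (\<lambda>\<alpha>. f \<alpha> + g \<alpha>) h \<gamma> = conv f h \<gamma> + conv g h \<gamma>"
proof -
  have "{\<alpha>. f \<alpha> + g \<alpha> \<noteq> 0} \<subseteq> frac_exps m"
  proof
    fix \<alpha> assume "\<alpha> \<in> {\<alpha>. f \<alpha> + g \<alpha> \<noteq> 0}"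
    hence "f \<alpha> \<noteq> 0 \<or> g \<alpha> \<noteq> 0" by auto
    thus "\<alpha> \<in> frac_exps m" using f g by auto
  qed
  thus ?thesis
    using conv_splits [OF m _ h] f g by (simp add: sum.distrib distrib_right)
qed

instantiation puiseux :: (comm_ring, finite) comm_ring
begin

lift_definition zero_puiseux :: "('a, 'b) puiseux" is "\<lambda>_. 0"
  by (auto intro: exI [of _ 1])

lift_definition plus_puiseux :: "('a, 'b) puiseux \<Rightarrow> ('a, 'b) puiseux \<Rightarrow> ('a, 'b) puiseux"
  is "\<lambda>f g \<alpha>. f \<alpha> + g \<alpha>"
proof -
  fix f g :: "rat ^ 'b \<Rightarrow> 'a"
  assume "\<exists>m>0. {\<alpha>. f \<alpha> \<noteq> 0} \<subseteq> frac_exps m" "\<exists>m>0. {\<alpha>. g \<alpha> \<noteq> 0} \<subseteq> frac_exps m"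
  then obtain m where m: "m > 0" "{\<alpha>. f \<alpha> \<noteq> 0} \<subseteq> frac_exps m" "{\<alpha>. g \<alpha> \<noteq> 0} \<subseteq> frac_exps m"
    by (rule common_frac_exps)
  have "{\<alpha>. f \<alpha> + g \<alpha> \<noteq> 0} \<subseteq> {\<alpha>. f \<alpha> \<noteq> 0} \<union> {\<alpha>. g \<alpha> \<noteq> 0}" by auto
  with m show "\<exists>m>0. {\<alpha>. f \<alpha> + g \<alpha> \<noteq> 0} \<subseteq> frac_exps m" by blast
qed

lift_definition uminus_puiseux :: "('a, 'b) puiseux \<Rightarrow> ('a, 'b) puiseux"
  is "\<lambda>f \<alpha>. - f \<alpha>"
  by simp

definition minus_puiseux :: "('a, 'b) puiseux \<Rightarrow> ('a, 'b) puiseux \<Rightarrow> ('a, 'b) puiseux" where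
  "minus_puiseux p q = p + - q"

lift_definition times_puiseux :: "('a, 'b) puiseux \<Rightarrow> ('a, 'b) puiseux \<Rightarrow> ('a, 'b) puiseux"
  is conv
  by (erule common_frac_exps, assumption) (metis conv_frac_exps)

instance
proof
  fix p q r :: "('a, 'b) puiseux"
  show "p + q + r = p + (q + r)" by transfer (simp add: add.assoc)
  show "p + q = q + p" by transfer (simp add: add.commute)
  show "0 + p = p" by transfer simp
  show "- p + p = 0" by transfer simp
  show "p - q = p + - q" by (simp add: minus_puiseux_def)
  show "p * q = q * p" by transfer (rule conv_commute)
  obtain m where m: "m > 0" "{\<alpha>. pcoeff p \<alpha> \<noteq> 0} \<subseteq> frac_exps m"
    "{\<alpha>. pcoeff q \<alpha> \<noteq> 0} \<subseteq> frac_exps m" "{\<alpha>. pcoeff r \<alpha> \<noteq> 0} \<subseteq> frac_exps m"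
  proof -
    obtain k where k: "k > 0" "{\<alpha>. pcoeff p \<alpha> \<noteq> 0} \<subseteq> frac_exps k"
      "{\<alpha>. pcoeff q \<alpha> \<noteq> 0} \<subseteq> frac_exps k"
      by (rule common_frac_exps [of "pcoeff p" "pcoeff q"]) (use pcoeff in blast)+
    obtain l where l: "l > 0" "{\<alpha>. pcoeff r \<alpha> \<noteq> 0} \<subseteq> frac_exps l"
      using pcoeff [of r] by blast
    have "frac_exps k \<subseteq> (frac_exps (k * l) :: (rat ^ 'b) set)"
      "frac_exps l \<subseteq> (frac_exps (k * l) :: (rat ^ 'b) set)"
      using frac_exps_mult [of l k] frac_exps_mult [of k l] k l by (auto simp: mult.commute)
    moreover have "k * l > 0" using k l by simp
    ultimately show ?thesis using that [of "k * l"] k(2,3) l(2) by (meson subset_trans)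
  qed
  show "p * q * r = p * (q * r)"
    using conv_assoc [OF m] by (simp add: pcoeff_inject [symmetric] times_puiseux.rep_eq)
  show "(p + q) * r = p * r + q * r"
    using conv_add_left [OF m]
    by (simp add: pcoeff_inject [symmetric] times_puiseux.rep_eq plus_puiseux.rep_eq fun_eq_iff)
qed

end

instantiation puiseux :: (comm_ring_1, finite) comm_ring_1
begin

definition one_puiseux :: "('a, 'b) puiseux" where
  "one_puiseux = pconst 1"

instance
proof
  fix p :: "('a, 'b) puiseux"
  show "1 * p = p"
    unfolding one_puiseux_def
  proof (transfer, rule ext)
    fix f :: "rat ^ 'b \<Rightarrow> 'a" and \<gamma> :: "rat ^ 'b"
    let ?e = "\<lambda>\<alpha>. if 0 \<le> (0 :: rat ^ 'b) \<and> \<alpha> = 0 then 1 else (0 :: 'a)"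
    have "conv ?e f \<gamma> = (\<Sum>\<alpha>\<in>{0}. ?e \<alpha> * f (\<gamma> - \<alpha>))"
      unfolding conv_def by (rule sum.mono_neutral_left) (auto split: if_splits)
    thus "conv ?e f \<gamma> = f \<gamma>" by simp
  qed
  show "(0 :: ('a, 'b) puiseux) \<noteq> 1"
    unfolding one_puiseux_def by transfer (auto simp: fun_eq_iff)
qed

end

text \<open>
  Two nonempty sets of exponents contain \<open>\<alpha>\<close>, \<open>\<beta>\<close> whose sum decomposes in only one way;
  this yields the absence of zero divisors.
\<close>

lemma min_coord:
  fixes A :: "(rat ^ 'n) set"
  assumes "m > 0" "A \<subseteq> frac_exps m" "A \<noteq> {}"
  shows "\<exists>\<alpha>\<in>A. \<forall>\<alpha>'\<in>A. \<alpha> $ i \<le> \<alpha>' $ i"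
proof -
  define P where "P a \<longleftrightarrow> (\<exists>\<alpha>\<in>A. \<alpha> $ i = of_nat a / of_nat m)" for a
  have ex: "\<exists>a. \<alpha> $ i = of_nat a / of_nat m" if "\<alpha> \<in> A" for \<alpha>
    using that assms by (auto simp: frac_exps_def)
  hence "\<exists>a. P a" using assms(3) by (auto simp: P_def)
  hence "P (LEAST a. P a)" by (rule LeastI_ex)
  then obtain \<alpha> where \<alpha>: "\<alpha> \<in> A" "\<alpha> $ i = of_nat (LEAST a. P a) / of_nat m"
    by (auto simp: P_def)
  have "\<alpha> $ i \<le> \<alpha>' $ i" if "\<alpha>' \<in> A" for \<alpha>'
  proof -
    obtain b where b: "\<alpha>' $ i = of_nat b / of_nat m" using ex [OF \<open>\<alpha>' \<in> A\<close>] by (rule exE)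
    hence "P b" using that by (auto simp: P_def)
    hence "(LEAST a. P a) \<le> b" by (rule Least_le)
    thus ?thesis using \<alpha> b assms(1) by (simp add: divide_right_mono)
  qed
  thus ?thesis using \<alpha> by blast
qed

lemma unique_split:
  fixes A B :: "(rat ^ 'n) set"
  assumes m: "m > 0" and A: "A \<subseteq> frac_exps m" "A \<noteq> {}" and B: "B \<subseteq> frac_exps m" "B \<noteq> {}"
  shows "\<exists>\<alpha>\<in>A. \<exists>\<beta>\<in>B. \<forall>\<alpha>'\<in>A. \<forall>\<beta>'\<in>B. \<alpha>' + \<beta>' = \<alpha> + \<beta> \<longrightarrow> \<alpha>' = \<alpha>"
proof -
  have "\<exists>\<alpha>\<in>A. \<exists>\<beta>\<in>B. \<forall>\<alpha>'\<in>A. \<forall>\<beta>'\<in>B. \<alpha>' + \<beta>' = \<alpha> + \<beta> \<longrightarrow> (\<forall>i\<in>I. \<alpha>' $ i = \<alpha> $ i)"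
    if "finite I" for I :: "'n set"
    using that A B
  proof (induction I arbitrary: A B rule: finite_induct)
    case empty
    thus ?case by auto
  next
    case (insert i I)
    obtain a where a: "a \<in> A" "\<And>\<alpha>'. \<alpha>' \<in> A \<Longrightarrow> a $ i \<le> \<alpha>' $ i"
      using min_coord [OF m] insert.prems by metis
    obtain b where b: "b \<in> B" "\<And>\<beta>'. \<beta>' \<in> B \<Longrightarrow> b $ i \<le> \<beta>' $ i"
      using min_coord [OF m] insert.prems by metis
    define A' where "A' = {\<alpha> \<in> A. \<alpha> $ i = a $ i}"
    define B' where "B' = {\<beta> \<in> B. \<beta> $ i = b $ i}"
    have "A' \<subseteq> frac_exps m" "A' \<noteq> {}" "B' \<subseteq> frac_exps m" "B' \<noteq> {}"
      using insert.prems a(1) b(1) by (auto simp: A'_def B'_def)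
    from insert.IH [OF this] obtain \<alpha> \<beta> where ab: "\<alpha> \<in> A'" "\<beta> \<in> B'"
      "\<And>\<alpha>' \<beta>'. \<alpha>' \<in> A' \<Longrightarrow> \<beta>' \<in> B' \<Longrightarrow> \<alpha>' + \<beta>' = \<alpha> + \<beta> \<Longrightarrow> \<forall>i\<in>I. \<alpha>' $ i = \<alpha> $ i"
      by blast
    have "\<forall>j\<in>insert i I. \<alpha>' $ j = \<alpha> $ j"
      if "\<alpha>' \<in> A" "\<beta>' \<in> B" "\<alpha>' + \<beta>' = \<alpha> + \<beta>" for \<alpha>' \<beta>'
    proof -
      have "\<alpha>' $ i + \<beta>' $ i = a $ i + b $ i"
        using that(3) ab(1,2) by (metis (mono_tags, lifting) A'_def B'_def mem_Collect_eq vector_add_component)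
      moreover have "a $ i \<le> \<alpha>' $ i" "b $ i \<le> \<beta>' $ i" using a b that by auto
      ultimately have "\<alpha>' $ i = a $ i" "\<beta>' $ i = b $ i" by linarith+
      hence mem: "\<alpha>' \<in> A'" "\<beta>' \<in> B'" using that(1,2) unfolding A'_def B'_def by blast+
      have "\<alpha> $ i = a $ i" using ab(1) unfolding A'_def by blast
      with \<open>\<alpha>' $ i = a $ i\<close> have "\<alpha>' $ i = \<alpha> $ i" by simp
      thus ?thesis using ab(3) [OF mem that(3)] by blast
    qed
    thus ?case using ab(1,2) unfolding A'_def B'_def by blast
  qed
  from this [OF finite, of UNIV] obtain \<alpha> \<beta> where ab: "\<alpha> \<in> A" "\<beta> \<in> B"
    "\<And>\<alpha>' \<beta>' i. \<alpha>' \<in> A \<Longrightarrow> \<beta>' \<in> B \<Longrightarrow> \<alpha>' + \<beta>' = \<alpha> + \<beta> \<Longrightarrow> \<alpha>' $ i = \<alpha> $ i"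
    by blast
  show ?thesis
  proof (intro bexI ballI impI)
    fix \<alpha>' \<beta>' assume "\<alpha>' \<in> A" "\<beta>' \<in> B" "\<alpha>' + \<beta>' = \<alpha> + \<beta>"
    hence "\<alpha>' $ i = \<alpha> $ i" for i by (rule ab(3))
    thus "\<alpha>' = \<alpha>" unfolding vec_eq_iff ..
  qed (fact ab(1,2))+
qed

instance puiseux :: (idom, finite) idom
proof
  fix p q :: "('a, 'b) puiseux"
  assume pq: "p \<noteq> 0" "q \<noteq> 0"
  let ?A = "{\<alpha>. pcoeff p \<alpha> \<noteq> 0}" and ?B = "{\<beta>. pcoeff q \<beta> \<noteq> 0}"
  obtain m where m: "m > 0" "?A \<subseteq> frac_exps m" "?B \<subseteq> frac_exps m"
    by (rule common_frac_exps [of "pcoeff p" "pcoeff q"]) (use pcoeff in blast)+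
  have "?A \<noteq> {}" "?B \<noteq> {}"
    using pq by (auto simp: pcoeff_inject [symmetric] zero_puiseux.rep_eq fun_eq_iff)
  from unique_split [OF m(1,2) this(1) m(3) this(2)] obtain \<alpha> \<beta> where ab: "\<alpha> \<in> ?A" "\<beta> \<in> ?B"
    "\<And>\<alpha>' \<beta>'. \<alpha>' \<in> ?A \<Longrightarrow> \<beta>' \<in> ?B \<Longrightarrow> \<alpha>' + \<beta>' = \<alpha> + \<beta> \<Longrightarrow> \<alpha>' = \<alpha>"
    by blast
  have "{\<alpha>'. pcoeff p \<alpha>' \<noteq> 0 \<and> pcoeff q (\<alpha> + \<beta> - \<alpha>') \<noteq> 0} = {\<alpha>}"
    using ab(1,2) ab(3) [of _ "\<alpha> + \<beta> - _"] by auto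
  hence "pcoeff (p * q) (\<alpha> + \<beta>) = pcoeff p \<alpha> * pcoeff q \<beta>"
    by (simp add: times_puiseux.rep_eq conv_def)
  also have "\<dots> \<noteq> 0" using ab(1,2) by simp
  finally show "p * q \<noteq> 0" by (metis zero_puiseux.rep_eq)
qed


section \<open>Rings of series with prescribed exponents\<close>

text \<open>
  \<open>\<bbbK>[[S]]\<close>. It consists of all formal series with exponents in \<open>S\<close> as soon as the
  exponents in \<open>S\<close> have a common denominator, see \<open>formal_series_is_puiseux\<close> below.
\<close>

definition series_over :: "(rat ^ 'n::finite) set \<Rightarrow> ('k::zero, 'n) puiseux set" where
  "series_over S = {p. Supp p \<subseteq> S}"

lemma formal_series_is_puiseux:
  fixes a :: "rat ^ 'n::finite \<Rightarrow> 'k::zero"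
  assumes "m > 0" "S \<subseteq> frac_exps m" "{\<alpha>. a \<alpha> \<noteq> 0} \<subseteq> S"
  shows "\<exists>p \<in> series_over S. pcoeff p = a"
proof -
  have "pcoeff (Abs_puiseux a) = a" using assms by (intro Abs_puiseux_inverse) blast
  thus ?thesis using assms(3) by (intro bexI [of _ "Abs_puiseux a"]) (auto simp: series_over_def Supp_def)
qed

abbreviation power_series :: "('k::zero, 'n::finite) puiseux set" where
  "power_series \<equiv> series_over nat_exps"


section \<open>Subrings, subfields and normalization\<close>

definition polys_over :: "'a::zero set \<Rightarrow> 'a poly set" where
  "polys_over A = {p. set (coeffs p) \<subseteq> A}"

definition ring_adjoin :: "'a::comm_ring_1 set \<Rightarrow> 'a \<Rightarrow> 'a set" where
  "ring_adjoin A x = {poly p x | p. p \<in> polys_over A}"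

definition is_subfield :: "'a::field set \<Rightarrow> bool" where
  "is_subfield L \<longleftrightarrow> 0 \<in> L \<and> 1 \<in> L \<and>
     (\<forall>x\<in>L. \<forall>y\<in>L. x - y \<in> L \<and> x * y \<in> L) \<and> (\<forall>x\<in>L. inverse x \<in> L)"

definition field_adjoin :: "'a::field set \<Rightarrow> 'a set \<Rightarrow> 'a set" where
  "field_adjoin F T = is_subfield hull (F \<union> T)"

text \<open>
  The field of fractions of a subring \<open>A\<close> of a domain, realised inside the field of
  fractions of that domain.
\<close>

definition fractions_of :: "'a::idom set \<Rightarrow> 'a fract set" where
  "fractions_of A = {Fract a b | a b. a \<in> A \<and> b \<in> A \<and> b \<noteq> 0}"

definition integral_over :: "'a::comm_ring_1 set \<Rightarrow> 'a \<Rightarrow> bool" where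
  "integral_over A z \<longleftrightarrow> (\<exists>p \<in> polys_over A. lead_coeff p = 1 \<and> poly p z = 0)"

definition normalization :: "'a::idom set \<Rightarrow> 'a fract set" where
  "normalization A = {z \<in> fractions_of A. integral_over (to_fract ` A) z}"

text \<open>
  Isomorphisms of \<open>\<bbbK>\<close>-algebras; \<open>cA\<close> and \<open>cB\<close> are the structure maps from \<open>\<bbbK>\<close> to
  \<open>A\<close> and \<open>B\<close>. Since \<open>cA 1 = 1\<close> and \<open>cB 1 = 1\<close>, preservation of \<open>1\<close> is included.
\<close>

definition is_algebra_iso ::
  "('k::field \<Rightarrow> 'a::comm_ring_1) \<Rightarrow> 'a set \<Rightarrow> ('k \<Rightarrow> 'b::comm_ring_1) \<Rightarrow> 'b set \<Rightarrow> ('a \<Rightarrow> 'b) \<Rightarrow> bool"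
where
  "is_algebra_iso cA A cB B \<phi> \<longleftrightarrow> bij_betw \<phi> A B \<and>
     (\<forall>x\<in>A. \<forall>y\<in>A. \<phi> (x + y) = \<phi> x + \<phi> y \<and> \<phi> (x * y) = \<phi> x * \<phi> y) \<and>
     (\<forall>c. \<phi> (cA c) = cB c)"


section \<open>Semigroups of exponents and saturation\<close>

definition semigroup_gen :: "(rat ^ 'n::finite) set \<Rightarrow> (rat ^ 'n) set" where
  "semigroup_gen G = {\<Sum>v\<in>F. of_nat (c v) *s v | F c. finite F \<and> F \<subseteq> G}"

definition group_gen :: "(rat ^ 'n::finite) set \<Rightarrow> (rat ^ 'n) set" where
  "group_gen G = {\<Sum>v\<in>F. of_int (c v) *s v | F c. finite F \<and> F \<subseteq> G}"

definition is_monoid :: "(rat ^ 'n::finite) set \<Rightarrow> bool" where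
  "is_monoid S \<longleftrightarrow> 0 \<in> S \<and> (\<forall>u\<in>S. \<forall>v\<in>S. u + v \<in> S)"

definition saturated :: "(rat ^ 'n::finite) set \<Rightarrow> bool" where
  "saturated S \<longleftrightarrow> is_monoid S \<and>
     (\<forall>k::nat. \<forall>v\<in>group_gen S. k > 0 \<longrightarrow> of_nat k *s v \<in> S \<longrightarrow> v \<in> S)"

definition saturation :: "(rat ^ 'n::finite) set \<Rightarrow> (rat ^ 'n) set" where
  "saturation S = saturated hull S"

lemma group_gen_mono: "S \<subseteq> T \<Longrightarrow> group_gen S \<subseteq> group_gen T"
  unfolding group_gen_def by blast

text \<open>The intersection defining the saturation is itself saturated.\<close>

lemma saturated_saturation: "saturated (saturation S)"
  unfolding saturation_def
proof (rule hull_in)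
  fix T :: "(rat ^ 'a) set set" assume T: "Ball T saturated"
  have "group_gen (\<Inter>T) \<subseteq> group_gen U" if "U \<in> T" for U
    using that by (intro group_gen_mono) auto
  thus "saturated (\<Inter>T)"
    using T unfolding saturated_def is_monoid_def by (auto simp: subset_iff)
qed

text \<open>
  If \<open>S\<close> consists of exponents with denominator \<open>k\<close> then so does its saturation, so that
  \<open>series_over (saturation S)\<close> consists of all formal series over \<open>saturation S\<close>.
\<close>

lemma saturated_frac_exps:
  assumes "k > 0"
  shows "saturated (frac_exps k :: (rat ^ 'n::finite) set)"
proof -
  have "v \<in> frac_exps k"
    if v: "v \<in> group_gen (frac_exps k)" and n: "n > 0" "of_nat n *s v \<in> frac_exps k"
    for n :: nat and v :: "rat ^ 'n"
  proof -
    obtain F c where F: "finite F" "F \<subseteq> frac_exps k" "v = (\<Sum>w\<in>F. of_int (c w) *s w)"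
      using v by (auto simp: group_gen_def)
    have "\<exists>a::nat. v $ i = of_nat a / of_nat k" for i
    proof -
      have "of_nat k * (of_int (c w) * w $ i) \<in> \<int>" if w: "w \<in> F" for w
      proof -
        obtain a :: nat where "w $ i = of_nat a / of_nat k"
          using subsetD [OF F(2) w] by (rule frac_expsE)
        thus ?thesis using assms by simp
      qed
      hence "of_nat k * v $ i \<in> \<int>"
        by (simp add: F(3) sum_distrib_left Ints_sum)
      then obtain z :: int where z: "of_nat k * v $ i = of_int z" by (auto elim: Ints_cases)
      have "0 \<le> of_nat n * v $ i" using frac_exps_nonneg [OF n(2), of i] by simp
      hence "0 \<le> v $ i" using n(1) by (simp add: zero_le_mult_iff)
      hence "0 \<le> (of_int z :: rat)" using z by (metis of_nat_0_le_iff zero_le_mult_iff)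
      then obtain a :: nat where "z = int a" by (auto elim: nonneg_int_cases)
      hence "v $ i = of_nat a / of_nat k" using z assms by (simp add: field_simps)
      thus ?thesis by blast
    qed
    thus ?thesis by (simp add: frac_exps_def)
  qed
  thus ?thesis by (auto simp: saturated_def is_monoid_def frac_exps_add)
qed

lemma saturation_subset_frac_exps:
  assumes "k > 0" "S \<subseteq> frac_exps k"
  shows "saturation S \<subseteq> frac_exps k"
  unfolding saturation_def using saturated_frac_exps assms by (intro hull_minimal)


section \<open>Puiseux polynomials and distinguished exponents\<close>

definition puiseux_polynomial :: "('k::field, 'n::finite) puiseux poly \<Rightarrow> bool" where
  "puiseux_polynomial f \<longleftrightarrow> f \<in> polys_over power_series \<and> lead_coeff f = 1 \<and>
     (\<exists>d (\<xi> :: nat \<Rightarrow> ('k, 'n) puiseux). f = (\<Prod>i\<in>{1..d}. [:- \<xi> i, 1:]))"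

text \<open>\<open>\<bbbK>((X))\<close>, inside the field of fractions of the ring of Puiseux series.\<close>

abbreviation power_series_field :: "('k::field, 'n::finite) puiseux fract set" where
  "power_series_field \<equiv> fractions_of power_series"

definition distinguished_exponents ::
  "('k::field, 'n::finite) puiseux \<Rightarrow> (rat ^ 'n) set \<Rightarrow> bool"
where
  "distinguished_exponents \<xi> \<Lambda> \<longleftrightarrow> finite \<Lambda> \<and> \<Lambda> \<subseteq> Supp \<xi> \<and>
     field_adjoin power_series_field {to_fract \<xi>} =
     field_adjoin power_series_field ((\<lambda>v. to_fract (X_pow v)) ` \<Lambda>)"

end

theory Submission
  imports "Jordan_Normal_Form.Char_Poly" "HOL-Analysis.Continuum_Not_Denumerable" Defs
begin

text \<open>
  Write \<open>K[[X]]\<close> for the power series, \<open>A = K[[X]][\<xi>]\<close>, \<open>M\<close> for the field of fractions of \<open>A\<close>,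
  and \<open>T\<close> for the saturation of the semigroup generated by \<open>\<nat>\<^sup>n\<close> and the distinguished exponents
  \<open>\<Lambda>\<close>.  Everything lives in the field of fractions of the ring of Puiseux series.  There the
  normalization of \<open>A\<close> is \<^emph>\<open>equal\<close> to the image of \<open>K[[T]]\<close>
  (\<open>normalization_eq_series_over\<close>), so the isomorphism is the inverse of the embedding \<open>to_fract\<close>.
  The field \<open>M\<close> is \<open>K((X))(\<xi>)\<close>, which by the choice of \<open>\<Lambda>\<close> is generated over \<open>K((X))\<close> by the
  monomials \<open>X\<^sup>\<lambda>\<close> with \<open>\<lambda> \<in> \<Lambda>\<close>.

  \<^emph>\<open>The normalization is contained in\<close> \<open>K[[T]]\<close>.  Since \<open>T\<close> contains \<open>\<nat>\<^sup>n\<close> and \<open>\<Lambda>\<close>, the field \<open>M\<close>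
  is contained in the field of fractions of \<open>K[[T]]\<close>.  An element \<open>z\<close> of the normalization is thus a
  quotient of two elements of \<open>K[[T]]\<close>, and it is integral over the ring of all Puiseux series.
  That ring is integrally closed (\<open>puiseux_integrally_closed\<close>), so \<open>z\<close> is a Puiseux series
  \<open>p\<close> with \<open>b p = q\<close> for some \<open>b, q \<in> K[[T]]\<close>, \<open>b \<noteq> 0\<close>.  Because \<open>T\<close> contains every nonnegative difference
  of two of its elements, cutting \<open>p\<close> down to its exponents in \<open>T\<close> commutes with multiplication by
  \<open>b\<close>, which forces \<open>p \<in> K[[T]]\<close> (\<open>series_over_quotient\<close>).

  To see that the ring of Puiseux series is integrally closed, order the exponents by a positive
  linear form \<open>w\<close> that is injective on \<open>\<rat>\<^sup>n\<close>; then leading exponents are additive.  If \<open>z = q/b\<close> is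
  integral then the powers of \<open>z\<close> have a common denominator \<open>d\<close>.  Divide \<open>q = b h + r\<close> in such a way
  that no exponent of \<open>r\<close> is of the form \<open>\<beta> + \<gamma>\<close> with \<open>\<gamma> \<ge> 0\<close>, where \<open>\<beta>\<close> is the leading exponent of
  \<open>b\<close> (\<open>division_with_remainder\<close>).  The powers of \<open>z - h = r/b\<close> still have the denominator \<open>d\<close>, so
  if \<open>r\<close> had a leading exponent \<open>\<rho>\<close>, comparing leading exponents in \<open>d r\<^sup>N = b\<^sup>N e\<^sub>N\<close> would give
  \<open>N (\<rho> - \<beta>) + \<delta> \<ge> 0\<close> for all \<open>N\<close>, hence \<open>\<rho> - \<beta> \<ge> 0\<close>, which is excluded.  Therefore \<open>z = h\<close>.

  \<^emph>\<open>The normalization contains\<close> \<open>K[[T]]\<close>.  Subtracting integer parts of exponents shows that every element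
  of \<open>K[[T]]\<close> is a finite sum of terms \<open>a\<^sub>r X\<^sup>r\<close> with \<open>a\<^sub>r \<in> K[[X]]\<close>, where \<open>r\<close> runs through the elements
  of \<open>T\<close> in the half-open unit cube (\<open>series_over_decomposition\<close>).  So \<open>K[[T]]\<close> is a finite module over
  \<open>K[[X]]\<close>, and its elements are integral by the determinant trick
  (\<open>integral_over_if_stable_span\<close>).  They lie in \<open>M\<close> because the set of
  all \<open>v \<ge> 0\<close> with \<open>X\<^sup>v \<in> M\<close> is a saturated monoid (\<open>saturated_exponents_of_subfield\<close>) that
  contains \<open>\<nat>\<^sup>n\<close> and \<open>\<Lambda>\<close>, hence \<open>T\<close>.
\<close>


section \<open>Subrings, fields of fractions and integrality\<close>

definition is_subring :: "'a::comm_ring_1 set \<Rightarrow> bool" where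
  "is_subring A \<longleftrightarrow> 1 \<in> A \<and> (\<forall>x\<in>A. \<forall>y\<in>A. x - y \<in> A \<and> x * y \<in> A)"

context
  fixes A :: "'a::comm_ring_1 set"
  assumes A: "is_subring A"
begin

lemma subring_1: "1 \<in> A"
  and subring_diff: "x \<in> A \<Longrightarrow> y \<in> A \<Longrightarrow> x - y \<in> A"
  and subring_mult: "x \<in> A \<Longrightarrow> y \<in> A \<Longrightarrow> x * y \<in> A"
  using A by (auto simp: is_subring_def)

lemma subring_0: "0 \<in> A"
  using subring_diff [OF subring_1 subring_1] by simp

lemma subring_uminus: "x \<in> A \<Longrightarrow> - x \<in> A"
  using subring_diff [OF subring_0] by simp

lemma subring_add: "x \<in> A \<Longrightarrow> y \<in> A \<Longrightarrow> x + y \<in> A"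
  using subring_diff [OF _ subring_uminus] by simp

lemma subring_sum: "(\<And>i. i \<in> I \<Longrightarrow> f i \<in> A) \<Longrightarrow> sum f I \<in> A"
  by (induction I rule: infinite_finite_induct) (auto intro: subring_0 subring_add)

lemma subring_prod: "(\<And>i. i \<in> I \<Longrightarrow> f i \<in> A) \<Longrightarrow> prod f I \<in> A"
  by (induction I rule: infinite_finite_induct) (auto intro: subring_1 subring_mult)

lemma subring_power: "x \<in> A \<Longrightarrow> x ^ n \<in> A"
  by (induction n) (auto intro: subring_1 subring_mult)

lemma subring_of_nat: "of_nat n \<in> A"
  by (induction n) (auto intro: subring_0 subring_1 subring_add)

lemma polys_over_iff: "p \<in> polys_over A \<longleftrightarrow> (\<forall>i. coeff p i \<in> A)"
proof
  assume "p \<in> polys_over A"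
  thus "\<forall>i. coeff p i \<in> A"
    using forall_coeffs_conv [of "\<lambda>c. c \<in> A" p] subring_0 unfolding polys_over_def by blast
next
  assume "\<forall>i. coeff p i \<in> A"
  thus "p \<in> polys_over A"
    using forall_coeffs_conv [of "\<lambda>c. c \<in> A" p] subring_0 unfolding polys_over_def by blast
qed

lemma is_subring_polys_over: "is_subring (polys_over A)"
  by (auto simp: is_subring_def polys_over_iff coeff_mult
      intro!: subring_0 subring_1 subring_diff subring_sum subring_mult)

lemma is_subring_ring_adjoin: "is_subring (ring_adjoin A x)"
proof -
  have P: "is_subring (polys_over A)" by (rule is_subring_polys_over)
  have "\<exists>r. a - b = poly r x \<and> r \<in> polys_over A" "\<exists>r. a * b = poly r x \<and> r \<in> polys_over A"
    if "a = poly p x" "b = poly q x" "p \<in> polys_over A" "q \<in> polys_over A" for a b p q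
    using that P unfolding is_subring_def by (metis poly_diff, metis poly_mult)
  moreover have "\<exists>r. 1 = poly r x \<and> r \<in> polys_over A"
    using P unfolding is_subring_def by (metis poly_1)
  ultimately show ?thesis unfolding is_subring_def ring_adjoin_def by blast
qed

lemma subset_ring_adjoin: "A \<subseteq> ring_adjoin A x"
proof
  fix a assume "a \<in> A"
  hence "[:a:] \<in> polys_over A" by (auto simp: polys_over_iff coeff_pCons subring_0 split: nat.splits)
  thus "a \<in> ring_adjoin A x" by (force simp: ring_adjoin_def)
qed

lemma in_ring_adjoin: "x \<in> ring_adjoin A x"
proof -
  have "[:0, 1:] \<in> polys_over A"
    by (auto simp: polys_over_iff coeff_pCons subring_0 subring_1 split: nat.splits)
  thus ?thesis by (force simp: ring_adjoin_def)
qed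

end

lemma ring_adjoin_subset:
  assumes A: "is_subring A" and B: "is_subring B" "A \<subseteq> B" "x \<in> B"
  shows "ring_adjoin A x \<subseteq> B"
proof
  fix y assume "y \<in> ring_adjoin A x"
  then obtain p where p: "y = poly p x" "\<forall>i. coeff p i \<in> A"
    by (auto simp: ring_adjoin_def polys_over_iff [OF A])
  show "y \<in> B"
    unfolding p poly_altdef
    by (intro subring_sum [OF B(1)] subring_mult [OF B(1)] subring_power [OF B(1)])
       (use p B in auto)
qed

lemma is_subring_to_fract_image:
  assumes A: "is_subring A"
  shows "is_subring (to_fract ` A)"
  unfolding is_subring_def
proof (intro conjI ballI)
  show "1 \<in> to_fract ` A" by (rule image_eqI [OF _ subring_1 [OF A]]) simp
  fix x y :: "'a fract" assume "x \<in> to_fract ` A" "y \<in> to_fract ` A"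
  then obtain a b where ab: "x = to_fract a" "y = to_fract b" "a \<in> A" "b \<in> A" by blast
  show "x - y \<in> to_fract ` A"
    by (rule image_eqI [OF _ subring_diff [OF A ab(3,4)]]) (simp add: ab)
  show "x * y \<in> to_fract ` A"
    by (rule image_eqI [OF _ subring_mult [OF A ab(3,4)]]) (simp add: ab)
qed

lemma integral_over_mono: "A \<subseteq> B \<Longrightarrow> integral_over A z \<Longrightarrow> integral_over B z"
  by (auto simp: integral_over_def polys_over_def)

lemma is_subfield_fractions_of:
  fixes A :: "'a::idom set"
  assumes A: "is_subring A"
  shows "is_subfield (fractions_of A)"
  unfolding is_subfield_def
proof (intro conjI ballI)
  note I = subring_0 [OF A] subring_1 [OF A] subring_mult [OF A] subring_diff [OF A]
  have "Fract a 1 \<in> fractions_of A" if "a \<in> A" for a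
    unfolding fractions_of_def using that I(2)
    by (intro CollectI exI [of _ a] exI [of _ 1]) simp
  from this [OF I(1)] this [OF I(2)] show "0 \<in> fractions_of A" "1 \<in> fractions_of A"
    by (simp_all only: Zero_fract_def One_fract_def)
  fix x assume "x \<in> fractions_of A"
  then obtain a b where x: "x = Fract a b" "a \<in> A" "b \<in> A" "b \<noteq> 0"
    by (auto simp: fractions_of_def)
  show "inverse x \<in> fractions_of A"
  proof (cases "a = 0")
    case True
    thus ?thesis using x \<open>0 \<in> fractions_of A\<close> by (simp add: fract_collapse)
  next
    case False
    thus ?thesis using x by (auto simp: fractions_of_def)
  qed
  fix y assume "y \<in> fractions_of A"
  then obtain c d where y: "y = Fract c d" "c \<in> A" "d \<in> A" "d \<noteq> 0"
    by (auto simp: fractions_of_def)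
  have "x - y = Fract (a * d - c * b) (b * d)" "x * y = Fract (a * c) (b * d)"
    using x y by simp_all
  moreover have "a * d - c * b \<in> A" "b * d \<in> A" "a * c \<in> A" "b * d \<noteq> 0"
    using x y I by auto
  ultimately show "x - y \<in> fractions_of A" "x * y \<in> fractions_of A"
    unfolding fractions_of_def by (smt (verit) mem_Collect_eq)+
qed

lemma to_fract_in_fractions_of: "is_subring A \<Longrightarrow> a \<in> A \<Longrightarrow> to_fract a \<in> fractions_of A"
  unfolding fractions_of_def to_fract_def
  by (intro CollectI exI [of _ a] exI [of _ 1]) (simp add: subring_1)

lemma is_subfield_imp_is_subring: "is_subfield K \<Longrightarrow> is_subring K"
  by (auto simp: is_subfield_def is_subring_def)

lemma is_subfield_divide: "is_subfield K \<Longrightarrow> x \<in> K \<Longrightarrow> y \<in> K \<Longrightarrow> x / y \<in> K"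
  by (auto simp: is_subfield_def divide_inverse)

lemma is_subfield_field_adjoin: "is_subfield (field_adjoin F T)"
  unfolding field_adjoin_def by (rule hull_in) (auto simp: is_subfield_def)

text \<open>
  Both sides are the smallest subfield containing \<open>A\<close> and \<open>x\<close>; this replaces fractions of
  elements of \<open>A[x]\<close>, on which integrality is stated, by the field in which distinguished exponents
  are defined.
\<close>

lemma fractions_of_ring_adjoin:
  fixes A :: "'a::idom set"
  assumes A: "is_subring A"
  shows "fractions_of (ring_adjoin A x) = field_adjoin (fractions_of A) {to_fract x}" (is "?L = ?M")
proof
  note B = is_subring_ring_adjoin [OF A, of x]
  have "fractions_of A \<subseteq> ?L"
    using subset_ring_adjoin [OF A, of x] unfolding fractions_of_def by blast
  moreover have "to_fract x \<in> ?L"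
    by (intro to_fract_in_fractions_of B in_ring_adjoin A)
  ultimately show "?M \<subseteq> ?L"
    unfolding field_adjoin_def by (intro hull_minimal is_subfield_fractions_of B) auto
next
  have M: "is_subfield ?M" by (rule is_subfield_field_adjoin)
  have sub: "fractions_of A \<union> {to_fract x} \<subseteq> ?M" unfolding field_adjoin_def by (rule hull_subset)
  have "is_subring (to_fract -` ?M)"
    using is_subfield_imp_is_subring [OF M] by (simp add: is_subring_def)
  hence "ring_adjoin A x \<subseteq> to_fract -` ?M"
    by (rule ring_adjoin_subset [OF A]) (use sub to_fract_in_fractions_of [OF A] in auto)
  thus "?L \<subseteq> ?M"
    unfolding fractions_of_def [of "ring_adjoin A x"]
    by (auto simp: Fract_conv_to_fract intro!: is_subfield_divide [OF M])
qed

text \<open>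
  The determinant trick: if multiplication by \<open>z\<close> maps the \<open>A\<close>-module spanned by finitely many
  \<open>b r\<close> to itself then \<open>(b r)\<^sub>r\<close> is an eigenvector, with eigenvalue \<open>z\<close>, of a square matrix with
  entries in \<open>A\<close>.  Hence \<open>z\<close> is a root of its characteristic polynomial, which is monic with
  coefficients in \<open>A\<close>.
\<close>

lemma integral_over_if_stable_span:
  fixes z :: "'a::field"
  assumes A: "is_subring A" and R: "finite R" and r0: "r0 \<in> R" "b r0 \<noteq> 0"
    and stable: "\<And>r. r \<in> R \<Longrightarrow> \<exists>a. (\<forall>s\<in>R. a s \<in> A) \<and> z * b r = (\<Sum>s\<in>R. a s * b s)"
  shows "integral_over A z"
proof -
  obtain a where a: "\<And>r s. r \<in> R \<Longrightarrow> s \<in> R \<Longrightarrow> a r s \<in> A"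
    "\<And>r. r \<in> R \<Longrightarrow> z * b r = (\<Sum>s\<in>R. a r s * b s)"
    using stable by metis
  define n where "n = card R"
  obtain e where e: "bij_betw e {0..<n} R"
    using ex_bij_betw_nat_finite [OF R] by (auto simp: n_def)
  have eR: "e i \<in> R" if "i < n" for i using e that by (auto simp: bij_betw_def)
  define M where "M = Matrix.mat n n (\<lambda>(i, j). a (e i) (e j))"
  define v where "v = Matrix.vec n (\<lambda>i. b (e i))"
  have M: "M \<in> carrier_mat n n" by (simp add: M_def)
  have "eigenvector M v z"
    unfolding eigenvector_def
  proof (intro conjI)
    show "v \<in> carrier_vec (dim_row M)" by (simp add: M_def v_def)
    obtain i0 where "i0 < n" "e i0 = r0" using e r0(1) by (auto simp: bij_betw_def)
    hence "vec_index v i0 \<noteq> vec_index (0\<^sub>v n) i0" using r0(2) by (simp add: v_def)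
    thus "v \<noteq> 0\<^sub>v (dim_row M)" by (auto simp: M_def)
    show "M *\<^sub>v v = z \<cdot>\<^sub>v v"
    proof (rule eq_vecI)
      fix i assume "i < dim_vec (z \<cdot>\<^sub>v v)"
      hence i: "i < n" by (simp add: v_def)
      have "vec_index (M *\<^sub>v v) i = (\<Sum>j = 0..<n. a (e i) (e j) * b (e j))"
        using i by (simp add: M_def v_def scalar_prod_def)
      also have "\<dots> = (\<Sum>s\<in>R. a (e i) s * b s)" by (rule sum.reindex_bij_betw [OF e])
      also have "\<dots> = vec_index (z \<cdot>\<^sub>v v) i" using i a(2) [OF eR [OF i]] by (simp add: v_def)
      finally show "vec_index (M *\<^sub>v v) i = vec_index (z \<cdot>\<^sub>v v) i" .
    qed (simp add: M_def v_def)
  qed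
  hence "poly (char_poly M) z = 0"
    using eigenvalue_root_char_poly [OF M] by (auto simp: eigenvalue_def)
  moreover have "lead_coeff (char_poly M) = 1"
    using degree_monic_char_poly [OF M] by simp
  moreover have "char_poly M \<in> polys_over A"
  proof -
    note P = is_subring_polys_over [OF A]
    have entry: "char_poly_matrix M $$ (i, j) \<in> polys_over A" if "i < n" "j < n" for i j
      using that a(1) [OF eR eR] subring_0 [OF A] subring_1 [OF A] subring_uminus [OF A]
      by (auto simp: char_poly_matrix_def M_def polys_over_iff [OF A] coeff_pCons split: nat.splits)
    have "signof p \<in> polys_over A" for p :: "nat \<Rightarrow> nat"
      using subring_1 [OF P] subring_uminus [OF P] by (simp add: sign_def)
    thus ?thesis
      unfolding char_poly_def det_def' [OF char_poly_matrix_closed [OF M]]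
      by (intro subring_sum [OF P] subring_mult [OF P] subring_prod [OF P] entry)
         (auto simp: permutes_in_image)
  qed
  ultimately show ?thesis by (auto simp: integral_over_def)
qed

lemma to_fract_power: "to_fract (x ^ n) = to_fract x ^ n"
  by (induction n) simp_all

text \<open>
  An integral element is almost integral: with \<open>z = a/b\<close> a root of a monic polynomial of degree
  \<open>e\<close>, the polynomial expresses every power of \<open>z\<close> through \<open>1, z, \<dots>, z\<^sup>e\<close>, and \<open>b\<^sup>e\<close> clears
  the denominators of these.
\<close>

lemma integral_common_denominator:
  fixes z :: "'a::idom fract"
  assumes "integral_over (range to_fract) z"
  shows "\<exists>d. d \<noteq> 0 \<and> (\<forall>N. to_fract d * z ^ N \<in> range to_fract)"
proof -
  obtain p where p: "p \<in> polys_over (range to_fract)" "lead_coeff p = 1" "poly p z = 0"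
    using assms by (auto simp: integral_over_def)
  obtain a b where z: "z = Fract a b" "b \<noteq> 0" by (cases z) auto
  have zb: "to_fract b * z = to_fract a" using z by (simp add: Fract_conv_to_fract)
  have R: "is_subring (range to_fract :: 'a fract set)"
    by (rule is_subring_to_fract_image) (simp add: is_subring_def)
  define e where "e = degree p"
  have "to_fract (b ^ e) * z ^ N \<in> range to_fract" for N
  proof (induction N rule: less_induct)
    case (less N)
    show ?case
    proof (cases "N \<le> e")
      case True
      have "b ^ e = b ^ (e - N) * b ^ N" using True by (simp flip: power_add)
      hence "to_fract (b ^ e) * z ^ N = to_fract (b ^ (e - N) * a ^ N)"
        by (simp add: to_fract_power power_mult_distrib mult_ac flip: zb)
      thus ?thesis by (metis rangeI)
    next
      case False
      have "0 = (\<Sum>i\<le>e. coeff p i * z ^ i)" using p(3) by (simp add: poly_altdef e_def)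
      also have "\<dots> = (\<Sum>i<e. coeff p i * z ^ i) + z ^ e"
        using p(2) by (simp add: e_def flip: lessThan_Suc_atMost)
      finally have "z ^ e = - (\<Sum>i<e. coeff p i * z ^ i)" by (simp add: eq_neg_iff_add_eq_0 add.commute)
      moreover have zN: "z ^ N = z ^ e * z ^ (N - e)" using False by (simp flip: power_add)
      ultimately have "to_fract (b ^ e) * z ^ N = - (\<Sum>i<e. coeff p i * z ^ i) * (to_fract (b ^ e) * z ^ (N - e))"
        by (simp add: zN)
      also have "\<dots> = (\<Sum>i<e. - coeff p i * (to_fract (b ^ e) * z ^ (N - e + i)))"
        by (simp add: sum_distrib_right sum_distrib_left power_add mult_ac sum_negf)
      also have "\<dots> \<in> range to_fract"
      proof (rule subring_sum [OF R])
        fix i assume "i \<in> {..<e}"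
        hence zi: "to_fract (b ^ e) * z ^ (N - e + i) \<in> range to_fract" using False by (intro less.IH) auto
        have ci: "- coeff p i \<in> range to_fract"
          using p(1) by (intro subring_uminus [OF R]) (simp add: polys_over_iff [OF R])
        show "- coeff p i * (to_fract (b ^ e) * z ^ (N - e + i)) \<in> range to_fract"
          by (rule subring_mult [OF R ci zi])
      qed
      finally show ?thesis .
    qed
  qed
  moreover have "b ^ e \<noteq> 0" using z(2) by simp
  ultimately show ?thesis by blast
qed



section \<open>Monomial weights and division of Puiseux series\<close>

text \<open>
  Weights are added one at a time: the rational combinations of finitely many reals form a countable
  set, so the interval \<open>(0, 1)\<close> contains a real outside of it.
\<close>

lemma ex_rationally_independent_reals:
  "\<exists>c :: 'n::finite \<Rightarrow> real. (\<forall>i. 0 < c i) \<and>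
     (\<forall>a :: 'n \<Rightarrow> rat. (\<Sum>i\<in>UNIV. of_rat (a i) * c i) = 0 \<longrightarrow> (\<forall>i. a i = 0))"
proof -
  have "\<exists>c :: 'n \<Rightarrow> real. (\<forall>i. 0 < c i) \<and>
     (\<forall>a :: 'n \<Rightarrow> rat. (\<Sum>i\<in>I. of_rat (a i) * c i) = 0 \<longrightarrow> (\<forall>i\<in>I. a i = 0))"
    if "finite I" for I :: "'n set"
    using that
  proof induction
    case empty
    show ?case by (rule exI [of _ "\<lambda>_. 1"]) simp
  next
    case (insert x I)
    then obtain c :: "'n \<Rightarrow> real" where c: "\<And>i. 0 < c i"
      "\<And>a :: 'n \<Rightarrow> rat. (\<Sum>i\<in>I. of_rat (a i) * c i) = 0 \<Longrightarrow> \<forall>i\<in>I. a i = 0"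
      by blast
    define C where "C = range (\<lambda>a :: 'n \<Rightarrow> rat. \<Sum>i\<in>I. of_rat (a i) * c i)"
    have "countable C"
      unfolding C_def by (intro countable_image) (rule countableI_type)
    moreover have "uncountable {0 <..< 1 :: real}"
      by (simp add: uncountable_open_interval)
    ultimately have "\<not> {0 <..< 1} \<subseteq> C" using countable_subset by blast
    then obtain t where "t \<in> {0 <..< 1}" and t2: "t \<notin> C" by blast
    hence t: "0 < t" "t \<notin> C" by auto
    define c' where "c' = c(x := t)"
    have "\<forall>i\<in>insert x I. a i = 0"
      if 0: "(\<Sum>i\<in>insert x I. of_rat (a i) * c' i) = 0" for a :: "'n \<Rightarrow> rat"
    proof -
      have "(\<Sum>i\<in>I. of_rat (a i) * c' i) = (\<Sum>i\<in>I. of_rat (a i) * c i)"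
        using insert.hyps(2) by (intro sum.cong) (auto simp: c'_def)
      with 0 have eq: "of_rat (a x) * t + (\<Sum>i\<in>I. of_rat (a i) * c i) = 0"
        using insert.hyps by (simp add: c'_def)
      have "a x = 0"
      proof (rule ccontr)
        assume ax: "a x \<noteq> 0"
        have "t = - (\<Sum>i\<in>I. of_rat (a i) * c i) / of_rat (a x)"
          using eq ax by (simp add: field_simps)
        also have "\<dots> = (\<Sum>i\<in>I. of_rat (- a i / a x) * c i)"
          by (simp add: of_rat_minus of_rat_divide sum_divide_distrib sum_negf)
        finally have "t \<in> C" unfolding C_def by (rule image_eqI [of _ _ "\<lambda>i. - a i / a x"]) simp
        with t(2) show False by simp
      qed
      with eq c(2) [of a] show ?thesis by simp
    qed
    moreover have "\<forall>i. 0 < c' i" using c(1) t(1) by (simp add: c'_def)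
    ultimately show ?case by blast
  qed
  from this [OF finite, of UNIV] show ?thesis by simp
qed

lemma frac_exps_diff:
  assumes "m > 0" "\<alpha> \<in> frac_exps m" "\<beta> \<in> frac_exps m" "0 \<le> \<alpha> - \<beta>"
  shows "\<alpha> - \<beta> \<in> frac_exps m"
proof -
  have "\<exists>a::nat. (\<alpha> - \<beta>) $ i = of_nat a / of_nat m" for i
  proof -
    obtain a where a: "\<alpha> $ i = of_nat a / of_nat m" using assms(2) by (rule frac_expsE)
    obtain b where b: "\<beta> $ i = of_nat b / of_nat m" using assms(3) by (rule frac_expsE)
    have "0 \<le> \<alpha> $ i - \<beta> $ i" using assms(4) by (simp add: less_eq_vec_def)
    hence "b \<le> a" using assms(1) by (simp add: a b divide_le_cancel)
    hence "(\<alpha> - \<beta>) $ i = of_nat (a - b) / of_nat m"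
      by (simp add: a b of_nat_diff diff_divide_distrib)
    thus ?thesis by blast
  qed
  thus ?thesis by (simp add: frac_exps_def)
qed

lemma pcoeff_diff: "pcoeff (p - q) \<alpha> = pcoeff p \<alpha> - pcoeff q \<alpha>"
  unfolding minus_puiseux_def plus_puiseux.rep_eq uminus_puiseux.rep_eq by simp

lemma Supp_diff: "Supp (p - q) \<subseteq> Supp p \<union> Supp q"
  by (auto simp: Supp_def pcoeff_diff)

lemma Supp_common_frac_exps:
  obtains m where "m > 0" "Supp p \<subseteq> frac_exps m" "Supp q \<subseteq> frac_exps m"
  using common_frac_exps [of "pcoeff p" "pcoeff q"] pcoeff [of p] pcoeff [of q]
  unfolding Supp_def by blast

lemma Supp_nonneg:
  assumes "\<alpha> \<in> Supp p"
  shows "0 \<le> \<alpha>"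
proof -
  obtain m where "Supp p \<subseteq> frac_exps m" by (rule Supp_common_frac_exps [of p p])
  thus ?thesis using assms frac_exps_nonneg by (auto simp: less_eq_vec_def)
qed

lemma Supp_mult: 
  assumes "\<gamma> \<in> Supp (p * q)"
  obtains \<alpha> where "\<alpha> \<in> Supp p" "\<gamma> - \<alpha> \<in> Supp q"
proof -
  have "{\<alpha>. pcoeff p \<alpha> \<noteq> 0 \<and> pcoeff q (\<gamma> - \<alpha>) \<noteq> 0} \<noteq> {}"
  proof
    assume 0: "{\<alpha>. pcoeff p \<alpha> \<noteq> 0 \<and> pcoeff q (\<gamma> - \<alpha>) \<noteq> 0} = {}"
    have "pcoeff (p * q) \<gamma> = 0" unfolding times_puiseux.rep_eq conv_def 0 by simp
    thus False using assms by (simp add: Supp_def)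
  qed
  thus ?thesis using that by (auto simp: Supp_def)
qed

lemma Supp_eq_empty_iff: "Supp p = {} \<longleftrightarrow> p = 0"
  by (auto simp: Supp_def pcoeff_inject [symmetric] zero_puiseux.rep_eq fun_eq_iff)

text \<open>
  A weight turns exponents into reals and thereby totally orders them, compatibly with addition.  By
  the last axiom, the exponents of a Puiseux series are well-ordered by their weight.
\<close>

locale monomial_weight =
  fixes w :: "rat ^ 'n::finite \<Rightarrow> real"
  assumes add: "w (\<alpha> + \<beta>) = w \<alpha> + w \<beta>"
    and inj: "w \<alpha> = w \<beta> \<Longrightarrow> \<alpha> = \<beta>"
    and finite_below: "m > 0 \<Longrightarrow> finite {\<alpha> \<in> frac_exps m. w \<alpha> \<le> c}"
begin

lemma diff: "w (\<alpha> - \<beta>) = w \<alpha> - w \<beta>"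
  using add [of "\<alpha> - \<beta>" \<beta>] by simp

definition leading :: "('k::field, 'n) puiseux \<Rightarrow> rat ^ 'n \<Rightarrow> bool" where
  "leading p \<alpha> \<longleftrightarrow> \<alpha> \<in> Supp p \<and> (\<forall>\<beta>\<in>Supp p. w \<alpha> \<le> w \<beta>)"

lemma leading_unique: "leading p \<alpha> \<Longrightarrow> leading p \<beta> \<Longrightarrow> \<alpha> = \<beta>"
  unfolding leading_def by (metis inj order.antisym)

lemma ex_leading:
  assumes "p \<noteq> 0"
  shows "\<exists>\<alpha>. leading p \<alpha>"
proof -
  obtain \<gamma> where \<gamma>: "\<gamma> \<in> Supp p" using assms Supp_eq_empty_iff by blast
  obtain m where m: "m > 0" "Supp p \<subseteq> frac_exps m" by (rule Supp_common_frac_exps [of p p])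
  define B where "B = {\<alpha> \<in> Supp p. w \<alpha> \<le> w \<gamma>}"
  have "finite B"
    by (rule finite_subset [OF _ finite_below [OF m(1), of "w \<gamma>"]]) (use m(2) in \<open>auto simp: B_def\<close>)
  moreover have "B \<noteq> {}" using \<gamma> by (auto simp: B_def)
  ultimately obtain \<alpha> where \<alpha>: "\<alpha> \<in> B" "\<And>\<beta>. \<beta> \<in> B \<Longrightarrow> w \<alpha> \<le> w \<beta>"
    using ex_min_if_finite [of "w ` B"] by (auto simp: not_less)
  hence "w \<alpha> \<le> w \<beta>" if "\<beta> \<in> Supp p" for \<beta>
    using that by (cases "w \<beta> \<le> w \<gamma>") (auto simp: B_def)
  with \<alpha>(1) show ?thesis by (auto simp: leading_def B_def)
qed

text \<open>
  A decomposition \<open>\<alpha> + \<beta> = \<alpha>' + \<beta>'\<close> into exponents of \<open>p\<close> and \<open>q\<close> must have both parts of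
  minimal weight, hence \<open>\<alpha>' = \<alpha>\<close>; so the coefficient at \<open>\<alpha> + \<beta>\<close> is the product of the two leading coefficients.
\<close>

lemma leading_mult:
  assumes p: "leading p \<alpha>" and q: "leading q \<beta>"
  shows "leading (p * q) (\<alpha> + \<beta>)"
proof -
  have "\<alpha>' = \<alpha>" if "\<alpha>' \<in> Supp p" "\<alpha> + \<beta> - \<alpha>' \<in> Supp q" for \<alpha>'
  proof -
    have "w \<alpha> \<le> w \<alpha>'" "w \<beta> \<le> w (\<alpha> + \<beta> - \<alpha>')" using that p q by (auto simp: leading_def)
    hence "w \<alpha>' = w \<alpha>" by (simp add: diff add)
    thus ?thesis by (rule inj)
  qed
  hence "{\<alpha>'. pcoeff p \<alpha>' \<noteq> 0 \<and> pcoeff q (\<alpha> + \<beta> - \<alpha>') \<noteq> 0} = {\<alpha>}"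
    using p q by (auto simp: leading_def Supp_def)
  hence "pcoeff (p * q) (\<alpha> + \<beta>) = pcoeff p \<alpha> * pcoeff q \<beta>"
    by (simp add: times_puiseux.rep_eq conv_def)
  hence "\<alpha> + \<beta> \<in> Supp (p * q)" using p q by (simp add: leading_def Supp_def)
  moreover have "w (\<alpha> + \<beta>) \<le> w \<gamma>" if \<gamma>: "\<gamma> \<in> Supp (p * q)" for \<gamma>
  proof -
    obtain \<delta> where "\<delta> \<in> Supp p" "\<gamma> - \<delta> \<in> Supp q" by (rule Supp_mult [OF \<gamma>])
    hence "w \<alpha> \<le> w \<delta>" "w \<beta> \<le> w (\<gamma> - \<delta>)" using p q by (auto simp: leading_def)
    thus ?thesis by (simp add: diff add)
  qed
  ultimately show ?thesis by (simp add: leading_def)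
qed

lemma leading_power:
  assumes "leading p \<alpha>"
  shows "leading (p ^ N) (of_nat N *s \<alpha>)"
proof (induction N)
  case 0
  have "Supp (1 :: ('a, 'n) puiseux) = {0}"
    by (auto simp: Supp_def one_puiseux_def pmonom.rep_eq split: if_splits)
  thus ?case by (simp add: leading_def)
next
  case (Suc N)
  have "of_nat (Suc N) *s \<alpha> = \<alpha> + of_nat N *s \<alpha>"
    by (simp add: vec_eq_iff algebra_simps)
  thus ?case using leading_mult [OF assms Suc] by simp
qed

text \<open>
  In \<open>b h\<close> the coefficient at \<open>\<beta> + \<gamma>\<close> is the leading coefficient of \<open>b\<close> times the one of \<open>h\<close> at
  \<open>\<gamma>\<close>, plus terms that involve \<open>h\<close> only at exponents of smaller weight than \<open>\<gamma>\<close>.  So \<open>h\<close> can be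
  chosen recursively such that \<open>b h\<close> agrees with \<open>q\<close> at all exponents \<open>\<beta> + \<gamma>\<close>, \<open>\<gamma> \<ge> 0\<close>.
\<close>

lemma division_with_remainder:
  assumes b: "leading b \<beta>"
  shows "\<exists>h r. q = b * h + r \<and> (\<forall>\<gamma>. 0 \<le> \<gamma> \<longrightarrow> \<beta> + \<gamma> \<notin> Supp r)"
proof -
  obtain m where m: "m > 0" "Supp b \<subseteq> frac_exps m" "Supp q \<subseteq> frac_exps m"
    by (rule Supp_common_frac_exps)
  define E where "E = (frac_exps m :: (rat ^ 'n) set)"
  define below where "below \<gamma> = {\<alpha> \<in> E. w \<alpha> < w \<gamma>}" for \<gamma>
  define c where "c = pcoeff b \<beta>"
  have c: "c \<noteq> 0" using b by (simp add: c_def leading_def Supp_def)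
  have \<beta>: "\<beta> \<in> E" using b m(2) by (auto simp: leading_def E_def)
  have fin: "finite (below \<gamma>)" for \<gamma>
    by (rule finite_subset [OF _ finite_below [OF m(1), of "w \<gamma>"]]) (auto simp: below_def E_def)
  define R where "R = {(\<alpha>, \<gamma>). \<alpha> \<in> below \<gamma>}"
  have "wf R"
  proof (rule wf_subset)
    show "R \<subseteq> measure (\<lambda>\<gamma>. card (below \<gamma>))"
    proof clarify
      fix \<alpha> \<gamma> assume R: "(\<alpha>, \<gamma>) \<in> R"
      hence "below \<alpha> \<subset> below \<gamma>" by (auto simp: R_def below_def)
      thus "(\<alpha>, \<gamma>) \<in> measure (\<lambda>\<gamma>. card (below \<gamma>))"
        by (simp add: psubset_card_mono fin)
    qed
  qed simp
  define step where "step h \<gamma> = (if \<gamma> \<in> E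
      then (pcoeff q (\<beta> + \<gamma>) - (\<Sum>\<alpha>\<in>below \<gamma>. h \<alpha> * pcoeff b (\<beta> + \<gamma> - \<alpha>))) / c else 0)"
    for h :: "rat ^ 'n \<Rightarrow> 'a" and \<gamma>
  have "\<exists>h. \<forall>\<gamma>. h \<gamma> = step h \<gamma>"
  proof (rule dependent_wf_choice [OF \<open>wf R\<close>])
    fix f g :: "rat ^ 'n \<Rightarrow> 'a" and \<gamma> r
    assume "\<And>\<alpha>. (\<alpha>, \<gamma>) \<in> R \<Longrightarrow> f \<alpha> = g \<alpha>"
    hence "step f \<gamma> = step g \<gamma>" by (simp add: step_def R_def cong: sum.cong)
    thus "(r = step f \<gamma>) = (r = step g \<gamma>)" by simp
  qed auto
  then obtain h where h: "\<And>\<gamma>. h \<gamma> = step h \<gamma>" by blast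
  have hE: "\<alpha> \<in> E" if "h \<alpha> \<noteq> 0" for \<alpha> using that h [of \<alpha>] by (auto simp: step_def split: if_splits)
  hence "{\<alpha>. h \<alpha> \<noteq> 0} \<subseteq> frac_exps m" by (auto simp: E_def)
  hence H: "pcoeff (Abs_puiseux h) = h" using m(1) by (intro Abs_puiseux_inverse) blast
  define r where "r = q - b * Abs_puiseux h"
  have "pcoeff r (\<beta> + \<gamma>) = 0" if \<gamma>: "\<gamma> \<in> E" for \<gamma>
  proof -
    have "pcoeff (Abs_puiseux h * b) (\<beta> + \<gamma>) =
        (\<Sum>\<alpha>\<in>insert \<gamma> (below \<gamma>). h \<alpha> * pcoeff b (\<beta> + \<gamma> - \<alpha>))"
      unfolding times_puiseux.rep_eq conv_def H
    proof (rule sum.mono_neutral_left)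
      show "{\<alpha>. h \<alpha> \<noteq> 0 \<and> pcoeff b (\<beta> + \<gamma> - \<alpha>) \<noteq> 0} \<subseteq> insert \<gamma> (below \<gamma>)"
      proof clarify
        fix \<alpha> assume \<alpha>: "h \<alpha> \<noteq> 0" "pcoeff b (\<beta> + \<gamma> - \<alpha>) \<noteq> 0" "\<alpha> \<notin> below \<gamma>"
        hence "w \<beta> \<le> w (\<beta> + \<gamma> - \<alpha>)" using b by (auto simp: leading_def Supp_def)
        moreover have "w \<gamma> \<le> w \<alpha>" using \<alpha> hE by (auto simp: below_def not_less)
        ultimately show "\<alpha> = \<gamma>" by (intro inj) (simp add: diff add)
      qed
    qed (use fin in auto)
    also have "\<dots> = h \<gamma> * c + (\<Sum>\<alpha>\<in>below \<gamma>. h \<alpha> * pcoeff b (\<beta> + \<gamma> - \<alpha>))"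
      using fin by (subst sum.insert) (auto simp: below_def c_def)
    also have "\<dots> = pcoeff q (\<beta> + \<gamma>)"
      using \<gamma> c by (subst h) (simp add: step_def)
    finally show ?thesis
      by (simp add: r_def pcoeff_diff mult.commute)
  qed
  \<comment> \<open>Exponents \<open>\<beta> + \<gamma>\<close> with \<open>\<gamma> \<notin> E\<close> are no exponents of \<open>r\<close>, whose denominators divide \<open>m\<close>.\<close>
  moreover have "\<gamma> \<in> E" if "0 \<le> \<gamma>" "\<beta> + \<gamma> \<in> Supp r" for \<gamma>
  proof -
    have "Supp (b * Abs_puiseux h) \<subseteq> E"
      unfolding Supp_def times_puiseux.rep_eq E_def H
      by (rule conv_frac_exps) (use hE m(2) in \<open>auto simp: E_def Supp_def\<close>)
    hence "Supp r \<subseteq> E" using m(3) Supp_diff [of q "b * Abs_puiseux h"]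
      unfolding r_def E_def by blast
    hence "\<beta> + \<gamma> - \<beta> \<in> E" unfolding E_def
      by (intro frac_exps_diff) (use that m \<beta> in \<open>auto simp: E_def\<close>)
    thus ?thesis by simp
  qed
  ultimately have "\<forall>\<gamma>. 0 \<le> \<gamma> \<longrightarrow> \<beta> + \<gamma> \<notin> Supp r"
    unfolding Supp_def by blast
  moreover have "q = b * Abs_puiseux h + r" by (simp add: r_def)
  ultimately show ?thesis by blast
qed

end

lemma ex_monomial_weight: "\<exists>w :: rat ^ 'n::finite \<Rightarrow> real. monomial_weight w"
proof -
  obtain c :: "'n \<Rightarrow> real" where c: "\<And>i. 0 < c i"
    "\<And>a :: 'n \<Rightarrow> rat. (\<Sum>i\<in>UNIV. of_rat (a i) * c i) = 0 \<Longrightarrow> \<forall>i. a i = 0"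
    using ex_rationally_independent_reals by blast
  define w where "w \<alpha> = (\<Sum>i\<in>UNIV. of_rat (\<alpha> $ i) * c i)" for \<alpha>
  have "monomial_weight w"
  proof
    fix \<alpha> \<beta> :: "rat ^ 'n"
    show "w (\<alpha> + \<beta>) = w \<alpha> + w \<beta>"
      by (simp add: w_def of_rat_add distrib_right sum.distrib)
    assume "w \<alpha> = w \<beta>"
    hence "(\<Sum>i\<in>UNIV. of_rat (\<alpha> $ i - \<beta> $ i) * c i) = 0"
      by (simp add: w_def of_rat_diff left_diff_distrib sum_subtractf)
    from c(2) [OF this] show "\<alpha> = \<beta>" by (simp add: vec_eq_iff)
  next
    fix m :: nat and C :: real
    assume m: "m > 0"
    define h :: "('n \<Rightarrow> nat) \<Rightarrow> rat ^ 'n" where "h a = (\<chi> i. of_nat (a i) / of_nat m)" for a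
    define B where "B i = nat \<lceil>C * real m / c i\<rceil>" for i
    have "{\<alpha> \<in> frac_exps m. w \<alpha> \<le> C} \<subseteq> h ` PiE UNIV (\<lambda>i. {..B i})"
    proof clarify
      fix \<alpha> :: "rat ^ 'n" assume \<alpha>: "\<alpha> \<in> frac_exps m" "w \<alpha> \<le> C"
      hence "\<forall>i. \<exists>a::nat. \<alpha> $ i = of_nat a / of_nat m" by (simp add: frac_exps_def)
      then obtain a :: "'n \<Rightarrow> nat" where a: "\<And>i. \<alpha> $ i = of_nat (a i) / of_nat m" by metis
      have "a i \<le> B i" for i
      proof -
        have "real (a i) / real m * c i \<le> w \<alpha>"
          unfolding w_def a using c(1)
          by (simp add: of_rat_divide) (rule member_le_sum, auto intro!: mult_nonneg_nonneg divide_nonneg_nonneg less_imp_le [OF c(1)])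
        also have "\<dots> \<le> C" by (rule \<alpha>(2))
        finally have "real (a i) \<le> C * real m / c i"
          using m c(1) [of i] by (simp add: field_simps)
        thus ?thesis unfolding B_def by linarith
      qed
      moreover have "\<alpha> = h a" by (simp add: h_def a vec_eq_iff)
      ultimately show "\<alpha> \<in> h ` PiE UNIV (\<lambda>i. {..B i})" by auto
    qed
    thus "finite {\<alpha> \<in> frac_exps m. w \<alpha> \<le> C}"
      by (rule finite_subset) (intro finite_imageI finite_PiE, auto)
  qed
  thus ?thesis by blast
qed

section \<open>The ring of Puiseux series is integrally closed\<close>

text \<open>
  The remainder \<open>r\<close> of the numerator modulo the denominator \<open>b\<close> must vanish: \<open>r/b\<close> is again almost
  integral, which makes the leading exponent of \<open>r\<close> dominate that of \<open>b\<close> in every coordinate.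
\<close>

theorem puiseux_integrally_closed:
  fixes z :: "('k::field, 'n::finite) puiseux fract"
  assumes "integral_over (range to_fract) z"
  shows "z \<in> range to_fract"
proof -
  let ?P = "range to_fract :: ('k, 'n) puiseux fract set"
  have P: "is_subring ?P"
    by (rule is_subring_to_fract_image) (simp add: is_subring_def)
  obtain d where d: "d \<noteq> 0" "\<And>N. to_fract d * z ^ N \<in> ?P"
    using integral_common_denominator [OF assms] by blast
  obtain w :: "rat ^ 'n \<Rightarrow> real" where "monomial_weight w" using ex_monomial_weight by blast
  then interpret monomial_weight w .
  obtain q b where z: "z = Fract q b" "b \<noteq> 0" by (cases z) auto
  obtain \<beta> where \<beta>: "leading b \<beta>" using ex_leading [OF z(2)] by blast
  obtain h r where r: "q = b * h + r" "\<And>\<gamma>. 0 \<le> \<gamma> \<Longrightarrow> \<beta> + \<gamma> \<notin> Supp r"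
    using division_with_remainder [OF \<beta>, of q] by blast
  have zh: "to_fract b * (z - to_fract h) = to_fract r"
    using z by (simp add: Fract_conv_to_fract r(1) field_simps)
  \<comment> \<open>Subtracting the Puiseux series \<open>h\<close> from \<open>z\<close> keeps \<open>d\<close> a denominator of all powers.\<close>
  have powers: "\<exists>e. d * r ^ N = b ^ N * e" for N
  proof -
    have "to_fract d * (z - to_fract h) ^ N =
        (\<Sum>i\<le>N. of_nat (N choose i) * (to_fract d * z ^ i) * (- to_fract h) ^ (N - i))"
      using binomial_ring [of z "- to_fract h" N]
      by (simp add: sum_distrib_left mult_ac)
    also have "\<dots> \<in> ?P"
      by (intro subring_sum [OF P] subring_mult [OF P] subring_power [OF P]
          subring_uminus [OF P] subring_of_nat [OF P] d) auto
    finally obtain e where "to_fract d * (z - to_fract h) ^ N = to_fract e" by blast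
    hence "to_fract b ^ N * to_fract e = to_fract d * (to_fract b * (z - to_fract h)) ^ N"
      by (simp add: power_mult_distrib mult_ac)
    also have "\<dots> = to_fract d * to_fract r ^ N" by (simp add: zh)
    finally have "to_fract (d * r ^ N) = to_fract (b ^ N * e)"
      by (simp add: to_fract_power)
    hence "d * r ^ N = b ^ N * e" by (simp only: to_fract_eq_iff)
    thus ?thesis by blast
  qed
  have "r = 0"
  proof (rule ccontr)
    assume "r \<noteq> 0"
    then obtain \<rho> where \<rho>: "leading r \<rho>" using ex_leading by blast
    obtain \<delta> where \<delta>: "leading d \<delta>" using ex_leading [OF d(1)] by blast
    have bound: "of_nat N * (\<beta> $ i - \<rho> $ i) \<le> \<delta> $ i" for N i
    proof -
      obtain e where e: "d * r ^ N = b ^ N * e" using powers by blast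
      have "d * r ^ N \<noteq> 0" using d(1) \<open>r \<noteq> 0\<close> by simp
      hence "e \<noteq> 0" using e by auto
      then obtain \<epsilon> where \<epsilon>: "leading e \<epsilon>" using ex_leading by blast
      have "\<delta> + of_nat N *s \<rho> = of_nat N *s \<beta> + \<epsilon>"
        using leading_mult [OF \<delta> leading_power [OF \<rho>, of N]]
          leading_mult [OF leading_power [OF \<beta>, of N] \<epsilon>] leading_unique unfolding e by blast
      hence "\<delta> $ i + of_nat N * \<rho> $ i = of_nat N * \<beta> $ i + \<epsilon> $ i"
        by (metis vector_add_component vector_smult_component)
      moreover have "0 \<le> \<epsilon> $ i"
        using \<epsilon> Supp_nonneg by (auto simp: leading_def less_eq_vec_def)
      ultimately show ?thesis by (simp add: right_diff_distrib)
    qed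
    have "\<beta> $ i \<le> \<rho> $ i" for i
    proof (rule ccontr)
      assume "\<not> \<beta> $ i \<le> \<rho> $ i"
      then obtain N where "\<delta> $ i < of_nat N * (\<beta> $ i - \<rho> $ i)"
        using ex_less_of_nat_mult [of "\<beta> $ i - \<rho> $ i" "\<delta> $ i"] by auto
      with bound [of N i] show False by simp
    qed
    hence "0 \<le> \<rho> - \<beta>" by (simp add: less_eq_vec_def)
    from r(2) [OF this] \<rho> show False by (simp add: leading_def)
  qed
  hence "z = to_fract h" using zh z(2) by simp
  thus ?thesis by blast
qed


section \<open>Series with exponents in a monoid\<close>

lemma Supp_pmonom_subset: "Supp (pmonom c \<mu>) \<subseteq> {\<mu>}"
  by (auto simp: Supp_def pmonom.rep_eq)

lemma pcoeff_X_pow_mult: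
  fixes p :: "('k::comm_ring_1, 'n::finite) puiseux"
  assumes "0 \<le> v"
  shows "pcoeff (X_pow v * p) \<gamma> = pcoeff p (\<gamma> - v)"
proof -
  have "conv (pcoeff (X_pow v)) (pcoeff p) \<gamma> =
      (\<Sum>\<alpha>\<in>{v}. pcoeff (X_pow v) \<alpha> * pcoeff p (\<gamma> - \<alpha>))"
    unfolding conv_def
    by (rule sum.mono_neutral_left) (auto simp: pmonom.rep_eq split: if_splits)
  thus ?thesis using assms by (simp add: times_puiseux.rep_eq pmonom.rep_eq)
qed

lemma X_pow_mult:
  assumes "0 \<le> u" "0 \<le> v"
  shows "X_pow u * X_pow v = (X_pow (u + v) :: ('k::comm_ring_1, 'n::finite) puiseux)"
proof -
  have "0 \<le> u + v" using assms by (simp add: less_eq_vec_def)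
  hence "pcoeff (X_pow u * X_pow v :: ('k, 'n) puiseux) \<gamma> = pcoeff (X_pow (u + v)) \<gamma>" for \<gamma>
    using assms by (auto simp: pcoeff_X_pow_mult pmonom.rep_eq)
  thus ?thesis by (simp add: fun_eq_iff flip: pcoeff_inject)
qed

lemma X_pow_nonzero:
  assumes "0 \<le> v"
  shows "X_pow v \<noteq> (0 :: ('k::comm_ring_1, 'n::finite) puiseux)"
proof -
  have "v \<in> Supp (X_pow v :: ('k, 'n) puiseux)" using assms by (simp add: Supp_def pmonom.rep_eq)
  thus ?thesis using Supp_eq_empty_iff by blast
qed

lemma pcoeff_sum: "pcoeff (sum f I) \<gamma> = (\<Sum>i\<in>I. pcoeff (f i) \<gamma>)"
  by (induction I rule: infinite_finite_induct)
     (simp_all add: zero_puiseux.rep_eq plus_puiseux.rep_eq)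

lemma is_subring_series_over:
  fixes T :: "(rat ^ 'n::finite) set"
  assumes T: "is_monoid T"
  shows "is_subring (series_over T :: ('k::field, 'n) puiseux set)"
  unfolding is_subring_def
proof (intro conjI ballI)
  show "1 \<in> (series_over T :: ('k, 'n) puiseux set)"
    using T Supp_pmonom_subset [of 1 0] unfolding series_over_def one_puiseux_def is_monoid_def by blast
  fix p q :: "('k, 'n) puiseux" assume pq: "p \<in> series_over T" "q \<in> series_over T"
  show "p - q \<in> series_over T"
    using pq Supp_diff [of p q] unfolding series_over_def by blast
  have "\<gamma> \<in> T" if \<gamma>: "\<gamma> \<in> Supp (p * q)" for \<gamma>
  proof -
    obtain \<alpha> where "\<alpha> \<in> Supp p" "\<gamma> - \<alpha> \<in> Supp q" by (rule Supp_mult [OF \<gamma>])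
    hence "\<alpha> + (\<gamma> - \<alpha>) \<in> T" using pq T unfolding series_over_def is_monoid_def by blast
    thus ?thesis by simp
  qed
  thus "p * q \<in> series_over T" by (auto simp: series_over_def)
qed

text \<open>
  For a monoid \<open>T\<close> of nonnegative vectors this says that \<open>T\<close> consists of all nonnegative vectors of the
  group \<open>T - T\<close>.  It is what saturation gives for exponents with a common denominator.
\<close>

definition difference_closed :: "(rat ^ 'n::finite) set \<Rightarrow> bool" where
  "difference_closed T \<longleftrightarrow> (\<forall>u\<in>T. \<forall>v\<in>T. 0 \<le> u - v \<longrightarrow> u - v \<in> T)"

text \<open>
  Let \<open>p0\<close> be the part of \<open>p\<close> with exponents in \<open>T\<close>.  Then \<open>b (p - p0)\<close> has all its exponents in \<open>T\<close>,
  as \<open>b p\<close> and \<open>b p0\<close> do.  It has none in \<open>T\<close>, since subtracting an exponent of \<open>b\<close> from it would yield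
  an exponent of \<open>p - p0\<close> that is a nonnegative difference of elements of \<open>T\<close>, hence in \<open>T\<close>.  So
  \<open>b (p - p0) = 0\<close>.
\<close>

lemma series_over_quotient:
  fixes b p :: "('k::field, 'n::finite) puiseux"
  assumes T: "is_monoid T" "difference_closed T"
    and b: "b \<in> series_over T" "b \<noteq> 0" and bp: "b * p \<in> series_over T"
  shows "p \<in> series_over T"
proof -
  obtain m where m: "m > 0" "Supp p \<subseteq> frac_exps m" by (rule Supp_common_frac_exps [of p p])
  have "\<exists>p0\<in>series_over (T \<inter> frac_exps m). pcoeff p0 = (\<lambda>\<alpha>. if \<alpha> \<in> T then pcoeff p \<alpha> else 0)"
    by (rule formal_series_is_puiseux [OF m(1)]) (use m(2) in \<open>auto simp: Supp_def\<close>)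
  then obtain p0 where p0: "p0 \<in> series_over T" "pcoeff p0 = (\<lambda>\<alpha>. if \<alpha> \<in> T then pcoeff p \<alpha> else 0)"
    by (auto simp: series_over_def)
  have "b * (p - p0) \<in> series_over T"
    using subring_diff [OF is_subring_series_over [OF T(1)] bp
        subring_mult [OF is_subring_series_over [OF T(1)] b(1) p0(1)]]
    by (simp add: right_diff_distrib)
  moreover have "\<gamma> \<notin> T" if \<gamma>: "\<gamma> \<in> Supp (b * (p - p0))" for \<gamma>
  proof
    assume "\<gamma> \<in> T"
    obtain \<alpha> where \<alpha>: "\<alpha> \<in> Supp b" "\<gamma> - \<alpha> \<in> Supp (p - p0)" by (rule Supp_mult [OF \<gamma>])
    have "\<alpha> \<in> T" using \<alpha>(1) b(1) by (auto simp: series_over_def)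
    hence "\<gamma> - \<alpha> \<in> T"
      using T(2) \<open>\<gamma> \<in> T\<close> Supp_nonneg [OF \<alpha>(2)] by (simp add: difference_closed_def)
    with \<alpha>(2) show False by (simp add: Supp_def pcoeff_diff p0(2))
  qed
  ultimately have "Supp (b * (p - p0)) = {}" by (auto simp: series_over_def)
  hence "p = p0" using b(2) by (simp add: Supp_eq_empty_iff)
  with p0(1) show ?thesis by simp
qed

lemma series_over_normal:
  fixes z :: "('k::field, 'n::finite) puiseux fract"
  assumes T: "is_monoid T" "difference_closed T"
    and z: "z \<in> fractions_of (series_over T)" "integral_over (range to_fract) z"
  shows "z \<in> to_fract ` series_over T"
proof -
  obtain q b where qb: "z = Fract q b" "q \<in> series_over T" "b \<in> series_over T" "b \<noteq> 0"
    using z(1) by (auto simp: fractions_of_def)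
  obtain p where p: "z = to_fract p" using puiseux_integrally_closed [OF z(2)] by blast
  hence "to_fract (b * p) = to_fract q"
    using qb by (simp add: Fract_conv_to_fract field_simps)
  hence "b * p = q" by (simp only: to_fract_eq_iff)
  hence "p \<in> series_over T" using series_over_quotient [OF T qb(3,4)] qb(2) by simp
  with p show ?thesis by blast
qed

text \<open>
  If \<open>T\<close> consists of nonnegative vectors, contains \<open>\<nat>\<^sup>n\<close> and is closed under nonnegative differences,
  these represent the classes of \<open>T\<close> modulo \<open>\<int>\<^sup>n\<close>.
\<close>

definition unit_box :: "(rat ^ 'n::finite) set \<Rightarrow> (rat ^ 'n) set" where
  "unit_box T = {r \<in> T. \<forall>i. r $ i < 1}"

lemma finite_unit_box:
  assumes "T \<subseteq> frac_exps k" and k: "k > 0"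
  shows "finite (unit_box T)"
proof -
  have "r \<in> splits k (\<chi> i. 1)" if "r \<in> unit_box T" for r
  proof -
    have r: "r \<in> frac_exps k" using that assms(1) by (auto simp: unit_box_def)
    have "(\<chi> i. 1) \<in> (frac_exps k :: (rat ^ 'a) set)"
      using k by (auto simp: frac_exps_def intro!: exI [of _ k])
    from frac_exps_diff [OF k this r] r show ?thesis
      using that by (simp add: splits_def unit_box_def less_eq_vec_def less_imp_le)
  qed
  thus ?thesis using finite_splits [OF k] by (metis finite_subset subsetI)
qed

text \<open>
  Every \<open>\<gamma> \<in> T\<close> is the sum of its coordinatewise integer part and its fractional part, and the latter
  belongs to \<open>T\<close>.  Collecting the terms of \<open>p\<close> whose exponents have the same fractional part \<open>r\<close> and
  dividing them by \<open>X\<^sup>r\<close> yields the coefficient \<open>a r\<close>.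
\<close>

lemma series_over_decomposition:
  fixes p :: "('k::field, 'n::finite) puiseux"
  assumes T: "difference_closed T" "nat_exps \<subseteq> T" "T \<subseteq> frac_exps k" and k: "k > 0"
    and p: "p \<in> series_over T"
  shows "\<exists>a. (\<forall>r\<in>unit_box T. a r \<in> power_series) \<and> p = (\<Sum>r\<in>unit_box T. a r * X_pow r)"
proof -
  define R where "R = unit_box T"
  have fin: "finite R" unfolding R_def by (rule finite_unit_box [OF T(3) k])
  have Rnn: "0 \<le> r $ i" if "r \<in> R" for r :: "rat ^ 'n" and i
    using that T(3) frac_exps_nonneg by (auto simp: R_def unit_box_def)
  have "\<exists>a\<in>power_series. pcoeff a = (\<lambda>\<alpha>. if \<alpha> \<in> nat_exps then pcoeff p (\<alpha> + r) else 0)" for r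
    by (rule formal_series_is_puiseux [of 1]) (auto simp: frac_exps_1 [symmetric])
  then obtain a where a: "\<And>r. a r \<in> power_series"
    "\<And>r. pcoeff (a r) = (\<lambda>\<alpha>. if \<alpha> \<in> nat_exps then pcoeff p (\<alpha> + r) else 0)"
    by metis
  have "pcoeff p \<gamma> = (\<Sum>r\<in>R. pcoeff (a r * X_pow r) \<gamma>)" for \<gamma>
  proof -
    have coeff: "pcoeff (a r * X_pow r) \<gamma> = (if \<gamma> - r \<in> nat_exps then pcoeff p \<gamma> else 0)"
      if "r \<in> R" for r
      using Rnn [OF that]
      by (simp add: mult.commute [of "a r"] pcoeff_X_pow_mult a(2) less_eq_vec_def)
    show ?thesis
    proof (cases "\<gamma> \<in> Supp p")
      case False
      hence "(\<Sum>r\<in>R. pcoeff (a r * X_pow r) \<gamma>) = 0"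
        using coeff by (intro sum.neutral) (simp add: Supp_def)
      thus ?thesis using False by (simp add: Supp_def)
    next
      case True
      define e :: "rat ^ 'n" where "e = (\<chi> i. of_int \<lfloor>\<gamma> $ i\<rfloor>)"
      have \<gamma>: "0 \<le> \<gamma> $ i" for i using Supp_nonneg [OF True] by (simp add: less_eq_vec_def)
      have "e $ i \<in> \<nat>" for i
      proof -
        have "e $ i = of_nat (nat \<lfloor>\<gamma> $ i\<rfloor>)" using \<gamma> [of i] by (simp add: e_def)
        thus ?thesis by simp
      qed
      hence e: "e \<in> nat_exps" by (simp add: nat_exps_def)
      have "0 \<le> \<gamma> - e" by (simp add: less_eq_vec_def e_def)
      moreover have "\<gamma> \<in> T" "e \<in> T" using True p e T(2) by (auto simp: series_over_def)
      ultimately have "\<gamma> - e \<in> T" using T(1) by (simp add: difference_closed_def)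
      moreover have "(\<gamma> - e) $ i < 1" for i by (simp add: e_def) linarith
      ultimately have R: "\<gamma> - e \<in> R" by (simp add: R_def unit_box_def)
      have "r = \<gamma> - e" if "r \<in> R" "\<gamma> - r \<in> nat_exps" for r
      proof -
        have "r $ i = frac (\<gamma> $ i)" for i
        proof -
          have "\<gamma> $ i - r $ i \<in> \<nat>" using that(2) by (simp add: nat_exps_def)
          moreover have "r $ i < 1" using that(1) by (simp add: R_def unit_box_def)
          ultimately show ?thesis
            using Rnn [OF that(1), of i] Nats_subset_Ints by (metis frac_unique_iff subsetD)
        qed
        thus ?thesis by (simp add: vec_eq_iff e_def frac_def)
      qed
      hence "(\<Sum>r\<in>R. pcoeff (a r * X_pow r) \<gamma>) = (\<Sum>r\<in>{\<gamma> - e}. pcoeff (a r * X_pow r) \<gamma>)"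
        by (intro sum.mono_neutral_right) (use fin R coeff in auto)
      thus ?thesis using coeff [OF R] e by simp
    qed
  qed
  hence "p = (\<Sum>r\<in>R. a r * X_pow r)"
    by (simp add: fun_eq_iff pcoeff_sum flip: pcoeff_inject)
  with a(1) show ?thesis unfolding R_def by (intro exI [of _ a] conjI ballI)
qed

lemma nat_exps_monoid: "is_monoid nat_exps"
  by (simp add: is_monoid_def nat_exps_def)

lemma X_pow_in_series_over: "v \<in> T \<Longrightarrow> X_pow v \<in> series_over T"
  using Supp_pmonom_subset [of 1 v] by (auto simp: series_over_def)

lemma series_over_integral:
  fixes p :: "('k::field, 'n::finite) puiseux"
  assumes T: "is_monoid T" "difference_closed T" "nat_exps \<subseteq> T" "T \<subseteq> frac_exps k" and k: "k > 0"
    and p: "p \<in> series_over T"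
  shows "integral_over (to_fract ` power_series) (to_fract p)"
proof -
  have zero: "0 \<in> unit_box T" using T(1) by (simp add: unit_box_def is_monoid_def)
  show ?thesis
  proof (rule integral_over_if_stable_span [OF _ finite_unit_box [OF T(4) k] zero])
    show "is_subring (to_fract ` power_series :: ('k, 'n) puiseux fract set)"
      by (intro is_subring_to_fract_image is_subring_series_over nat_exps_monoid)
    show "to_fract (X_pow 0 :: ('k, 'n) puiseux) \<noteq> 0" by (simp add: X_pow_nonzero)
    fix r assume "r \<in> unit_box T"
    hence "p * X_pow r \<in> series_over T"
      using p by (intro subring_mult [OF is_subring_series_over [OF T(1)]] X_pow_in_series_over)
        (auto simp: unit_box_def)
    then obtain a where a: "\<forall>s\<in>unit_box T. a s \<in> power_series"
      "p * X_pow r = (\<Sum>s\<in>unit_box T. a s * X_pow s)"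
      using series_over_decomposition [OF T(2-4) k] by blast
    have "to_fract p * to_fract (X_pow r) =
        (\<Sum>s\<in>unit_box T. to_fract (a s) * to_fract (X_pow s))"
      using arg_cong [OF a(2), of to_fract] by simp
    with a(1) show "\<exists>a. (\<forall>s\<in>unit_box T. a s \<in> to_fract ` power_series) \<and>
        to_fract p * to_fract (X_pow r) = (\<Sum>s\<in>unit_box T. a s * to_fract (X_pow s))"
      by (intro exI [of _ "\<lambda>s. to_fract (a s)"]) auto
  qed
qed

section \<open>Monoids of exponents and saturation\<close>

lemma monoid_sum: "is_monoid U \<Longrightarrow> (\<And>i. i \<in> I \<Longrightarrow> f i \<in> U) \<Longrightarrow> sum f I \<in> U"
  by (induction I rule: infinite_finite_induct) (auto simp: is_monoid_def)

lemma monoid_multiple: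
  assumes U: "is_monoid U" "v \<in> U"
  shows "of_nat n *s v \<in> U"
proof (induction n)
  case (Suc n)
  have "of_nat (Suc n) *s v = v + of_nat n *s v" by (simp add: vec_eq_iff algebra_simps)
  thus ?case using Suc U by (simp add: is_monoid_def)
qed (use U in \<open>simp add: is_monoid_def\<close>)

lemma semigroup_gen_minimal: "is_monoid U \<Longrightarrow> G \<subseteq> U \<Longrightarrow> semigroup_gen G \<subseteq> U"
  by (auto simp: semigroup_gen_def intro!: monoid_sum monoid_multiple)

lemma subset_semigroup_gen: "G \<subseteq> semigroup_gen G"
proof
  fix v assume "v \<in> G"
  thus "v \<in> semigroup_gen G"
    unfolding semigroup_gen_def by (intro CollectI exI [of _ "{v}"] exI [of _ "\<lambda>_. 1"]) simp
qed

lemma group_gen_monoid_difference: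
  assumes U: "is_monoid U" and v: "v \<in> group_gen U"
  obtains a b where "a \<in> U" "b \<in> U" "v = a - b"
proof -
  obtain F c where F: "finite F" "F \<subseteq> U" "v = (\<Sum>w\<in>F. of_int (c w) *s w)"
    using v by (auto simp: group_gen_def)
  have "of_int c *s w = of_nat (nat c) *s w - of_nat (nat (- c)) *s w" for c and w :: "rat ^ 'a"
    by (cases "0 \<le> c") (simp_all add: vec_eq_iff)
  hence "v = (\<Sum>w\<in>F. of_nat (nat (c w)) *s w) - (\<Sum>w\<in>F. of_nat (nat (- c w)) *s w)"
    by (simp add: F(3) sum_subtractf)
  moreover have "(\<Sum>w\<in>F. of_nat (nat (f w)) *s w) \<in> U" for f
    using F(2) by (intro monoid_sum monoid_multiple U) auto
  ultimately show ?thesis by (intro that)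
qed

text \<open>
  A nonnegative difference of elements of \<open>T\<close> has denominator \<open>k\<close>, so that its \<open>k\<close>-fold multiple lies
  in \<open>\<nat>\<^sup>n\<close> and hence in \<open>T\<close>; by saturation so does the difference itself.
\<close>

lemma saturated_difference_closed:
  assumes T: "saturated T" "nat_exps \<subseteq> T" "T \<subseteq> frac_exps k" and k: "k > 0"
  shows "difference_closed T"
  unfolding difference_closed_def
proof (intro ballI impI)
  fix u v assume uv: "u \<in> T" "v \<in> T" "0 \<le> u - v"
  have "u - v \<in> frac_exps k" using uv T(3) by (intro frac_exps_diff [OF k]) auto
  hence "\<exists>a::nat. of_nat k * (u - v) $ i = of_nat a" for i
    by (rule frac_expsE [of _ _ i]) (use k in auto)
  hence "of_nat k *s (u - v) \<in> nat_exps" by (auto simp: nat_exps_def Nats_def)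
  moreover have "u - v \<in> group_gen T"
  proof (cases "u = v")
    case True
    thus ?thesis unfolding group_gen_def by (intro CollectI exI [of _ "{}"]) simp
  next
    case False
    thus ?thesis using uv unfolding group_gen_def
      by (intro CollectI exI [of _ "{u, v}"] exI [of _ "\<lambda>w. if w = u then 1 else -1"])
         (auto simp: vec_eq_iff [of "u - v"])
  qed
  ultimately show "u - v \<in> T" using T(1,2) k unfolding saturated_def by blast
qed

text \<open>
  The exponents of monomials in \<open>M\<close> form a monoid.  A vector \<open>v\<close> of the group generated by it is a
  difference \<open>a - b\<close> of two of its elements; if \<open>v \<ge> 0\<close> then \<open>X\<^sup>v\<close> is the quotient
  \<open>X\<^sup>a / X\<^sup>b\<close>, hence in \<open>M\<close>.
\<close>

lemma saturated_exponents_of_subfield: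
  fixes M :: "('k::field, 'n::finite) puiseux fract set"
  assumes M: "is_subfield M"
  shows "saturated {v. 0 \<le> v \<and> to_fract (X_pow v) \<in> M}" (is "saturated ?U")
  unfolding saturated_def
proof (intro conjI allI ballI impI)
  note M' = is_subfield_imp_is_subring [OF M]
  have "to_fract (X_pow (u + v)) \<in> M"
    if "0 \<le> u" "0 \<le> v" "to_fract (X_pow u) \<in> M" "to_fract (X_pow v) \<in> M" for u v
    using subring_mult [OF M' that(3,4)] X_pow_mult [OF that(1,2)]
    by (metis to_fract_mult)
  moreover have "to_fract (X_pow 0) \<in> M"
    using subring_1 [OF M'] by (simp flip: one_puiseux_def)
  moreover have "0 \<le> u + v" if "0 \<le> u" "0 \<le> v" for u v :: "rat ^ 'n"
    using that by (simp add: less_eq_vec_def)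
  ultimately show U: "is_monoid ?U" unfolding is_monoid_def by blast
  fix n :: nat and v
  assume v: "v \<in> group_gen ?U" "n > 0" "of_nat n *s v \<in> ?U"
  have "0 \<le> v $ i" for i
  proof -
    have "0 \<le> of_nat n * v $ i" using v(3) by (simp add: less_eq_vec_def)
    thus ?thesis using v(2) by (simp add: zero_le_mult_iff)
  qed
  hence v0: "0 \<le> v" by (simp add: less_eq_vec_def)
  obtain a b where ab: "a \<in> ?U" "b \<in> ?U" "v = a - b"
    using group_gen_monoid_difference [OF U v(1)] by blast
  have "X_pow b * X_pow v = (X_pow a :: ('k, 'n) puiseux)"
    using ab v0 by (subst X_pow_mult) auto
  hence "to_fract (X_pow b) * to_fract (X_pow v) = to_fract (X_pow a :: ('k, 'n) puiseux)"
    by (metis to_fract_mult)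
  hence "to_fract (X_pow v :: ('k, 'n) puiseux) = to_fract (X_pow a) / to_fract (X_pow b)"
    using ab(2) X_pow_nonzero [of b, where 'k = 'k] by (simp add: nonzero_eq_divide_eq mult.commute)
  hence "to_fract (X_pow v) \<in> M" using ab M by (simp add: is_subfield_divide)
  with v0 show "v \<in> ?U" by simp
qed

section \<open>The normalization as a ring of series\<close>

text \<open>
  As explained at the beginning: \<open>\<subseteq>\<close> comes from the Puiseux series being integrally closed, \<open>\<supseteq>\<close> from
  \<open>K[[T]]\<close> being a finite \<open>K[[X]]\<close>-module inside the field of fractions of \<open>K[[X]][\<xi>]\<close>.
\<close>

theorem normalization_eq_series_over:
  fixes \<xi> :: "('k::field, 'n::finite) puiseux"
  assumes k: "k > 0" and \<Lambda>: "\<Lambda> \<subseteq> frac_exps k"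
    and field: "field_adjoin power_series_field {to_fract \<xi>} =
      field_adjoin power_series_field ((\<lambda>v. to_fract (X_pow v)) ` \<Lambda>)"
  shows "normalization (ring_adjoin power_series \<xi>) =
    to_fract ` series_over (saturation (semigroup_gen (nat_exps \<union> \<Lambda>)))"
proof -
  define T where "T = saturation (semigroup_gen (nat_exps \<union> \<Lambda>))"
  define A where "A = ring_adjoin power_series \<xi>"
  define M where "M = fractions_of A"
  have PS: "is_subring (power_series :: ('k, 'n) puiseux set)"
    by (intro is_subring_series_over nat_exps_monoid)
  have A: "is_subring A" unfolding A_def by (rule is_subring_ring_adjoin [OF PS])
  have M: "is_subfield M" unfolding M_def by (rule is_subfield_fractions_of [OF A])
  have M_eq: "M = field_adjoin power_series_field ((\<lambda>v. to_fract (X_pow v)) ` \<Lambda>)"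
    unfolding M_def A_def fractions_of_ring_adjoin [OF PS] field ..
  have gens: "nat_exps \<union> \<Lambda> \<subseteq> frac_exps k"
    using \<Lambda> frac_exps_mult [OF k, of 1] by (simp add: frac_exps_1 [symmetric])
  have "nat_exps \<union> \<Lambda> \<subseteq> T"
    unfolding T_def saturation_def by (rule order_trans [OF subset_semigroup_gen hull_subset])
  hence T_gens: "nat_exps \<subseteq> T" "\<Lambda> \<subseteq> T" by auto
  have T_frac: "T \<subseteq> frac_exps k"
    unfolding T_def using saturated_frac_exps [OF k] gens
    by (intro saturation_subset_frac_exps k semigroup_gen_minimal) (auto simp: saturated_def)
  have T_sat: "saturated T" unfolding T_def by (rule saturated_saturation)
  hence T_mon: "is_monoid T" by (simp add: saturated_def)
  have T_diff: "difference_closed T"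
    by (rule saturated_difference_closed [OF T_sat T_gens(1) T_frac k])
  have PSF_M: "power_series_field \<subseteq> M"
    unfolding M_eq field_adjoin_def by (rule order_trans [OF _ hull_subset]) simp
  have ps_M: "to_fract a \<in> M" if "a \<in> power_series" for a
    using that to_fract_in_fractions_of [OF PS] PSF_M by blast

  have T_M: "T \<subseteq> {v. 0 \<le> v \<and> to_fract (X_pow v) \<in> M}" (is "_ \<subseteq> ?U")
    unfolding T_def saturation_def
  proof (intro hull_minimal semigroup_gen_minimal)
    show "saturated ?U" by (rule saturated_exponents_of_subfield [OF M])
    thus "is_monoid ?U" by (simp add: saturated_def)
    have "0 \<le> v" if "v \<in> nat_exps \<union> \<Lambda>" for v
      using subsetD [OF gens that] frac_exps_nonneg by (auto simp: less_eq_vec_def)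
    moreover have "to_fract (X_pow v) \<in> M" if "v \<in> nat_exps" for v
      using that by (intro ps_M X_pow_in_series_over)
    moreover have "to_fract (X_pow v) \<in> M" if "v \<in> \<Lambda>" for v
      unfolding M_eq field_adjoin_def by (rule subsetD [OF hull_subset]) (use that in simp)
    ultimately show "nat_exps \<union> \<Lambda> \<subseteq> ?U" by blast
  qed

  have "z \<in> to_fract ` series_over T" if z: "z \<in> normalization A" for z
  proof (rule series_over_normal [OF T_mon T_diff])
    have "M \<subseteq> fractions_of (series_over T)"
      unfolding M_eq field_adjoin_def
    proof (rule hull_minimal)
      note S = is_subring_series_over [OF T_mon]
      show "is_subfield (fractions_of (series_over T) :: ('k, 'n) puiseux fract set)"
        by (rule is_subfield_fractions_of [OF S])
      have "power_series \<subseteq> (series_over T :: ('k, 'n) puiseux set)" using T_gens(1) by (auto simp: series_over_def)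
      hence "power_series_field \<subseteq> (fractions_of (series_over T) :: ('k, 'n) puiseux fract set)"
        unfolding fractions_of_def by blast
      moreover have "to_fract (X_pow v) \<in> (fractions_of (series_over T) :: ('k, 'n) puiseux fract set)"
        if "v \<in> \<Lambda>" for v
        using that T_gens(2) by (intro to_fract_in_fractions_of [OF S] X_pow_in_series_over) auto
      ultimately show "power_series_field \<union> (\<lambda>v. to_fract (X_pow v)) ` \<Lambda> \<subseteq>
          (fractions_of (series_over T) :: ('k, 'n) puiseux fract set)"
        by blast
    qed
    thus "z \<in> fractions_of (series_over T)" using z by (auto simp: normalization_def M_def)
    show "integral_over (range to_fract) z"
      using z integral_over_mono [of "to_fract ` A" "range to_fract" z]
      by (auto simp: normalization_def)
  qed
  moreover have "to_fract p \<in> normalization A" if p: "p \<in> series_over T" for p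
  proof -
    obtain a where a: "\<forall>r\<in>unit_box T. a r \<in> power_series" "p = (\<Sum>r\<in>unit_box T. a r * X_pow r)"
      using series_over_decomposition [OF T_diff T_gens(1) T_frac k p] by blast
    have "to_fract p = (\<Sum>r\<in>unit_box T. to_fract (a r) * to_fract (X_pow r))" by (simp add: a(2))
    also have "\<dots> \<in> M"
    proof (rule subring_sum [OF is_subfield_imp_is_subring [OF M]])
      fix r assume r: "r \<in> unit_box T"
      hence "to_fract (X_pow r) \<in> M" using T_M by (auto simp: unit_box_def)
      with ps_M a(1) r show "to_fract (a r) * to_fract (X_pow r) \<in> M"
        by (intro subring_mult [OF is_subfield_imp_is_subring [OF M]]) auto
    qed
    finally have "to_fract p \<in> fractions_of A" by (simp add: M_def)
    moreover have "integral_over (to_fract ` A) (to_fract p)"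
    proof (rule integral_over_mono)
      show "to_fract ` power_series \<subseteq> to_fract ` A"
        unfolding A_def by (intro image_mono subset_ring_adjoin PS)
      show "integral_over (to_fract ` power_series) (to_fract p)"
        by (rule series_over_integral [OF T_mon T_diff T_gens(1) T_frac k p])
    qed
    ultimately show ?thesis by (simp add: normalization_def)
  qed
  ultimately show ?thesis unfolding A_def T_def by blast
qed

theorem lemma5p1:
  fixes f :: "('k::alg_closed_field, 'n::finite) puiseux poly"
    and \<xi> :: "('k, 'n) puiseux"
    and lam :: "nat \<Rightarrow> rat ^ 'n"
    and g k :: nat
  assumes "puiseux_polynomial f"
    and "\<not> CHAR('k) dvd degree f"
    and "poly f \<xi> = 0"
    and "k > 0"
    and "\<forall>j\<in>{1..g}. lam j \<in> frac_exps k"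
    and "distinguished_exponents \<xi> (lam ` {1..g})"
  shows "\<exists>\<phi>. is_algebra_iso
           (\<lambda>c. to_fract (pconst c)) (normalization (ring_adjoin power_series \<xi>))
           (pconst :: 'k \<Rightarrow> ('k, 'n) puiseux)
             (series_over (saturation (semigroup_gen (nat_exps \<union> lam ` {1..g})))) \<phi>"
proof -
  let ?S = "series_over (saturation (semigroup_gen (nat_exps \<union> lam ` {1..g}))) :: ('k, 'n) puiseux set"
  have N: "normalization (ring_adjoin power_series \<xi>) = to_fract ` ?S"
    using assms(4-6)
    by (intro normalization_eq_series_over) (auto simp: distinguished_exponents_def)
  define \<phi> :: "('k, 'n) puiseux fract \<Rightarrow> ('k, 'n) puiseux" where "\<phi> = the_inv to_fract"
  have \<phi>: "\<phi> (to_fract p) = p" for p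
    unfolding \<phi>_def by (rule the_inv_f_f) (simp add: inj_on_def)
  have "bij_betw \<phi> (to_fract ` ?S) ?S"
    by (rule bij_betw_byWitness [of _ to_fract]) (auto simp: \<phi>)
  moreover have "\<phi> (to_fract p + to_fract q) = p + q" "\<phi> (to_fract p * to_fract q) = p * q" for p q
    using \<phi> [of "p + q"] \<phi> [of "p * q"] by simp_all
  ultimately have "is_algebra_iso (\<lambda>c. to_fract (pconst c)) (to_fract ` ?S) pconst ?S \<phi>"
    by (auto simp: is_algebra_iso_def \<phi>)
  thus ?thesis unfolding N by blast
qed

end
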